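(* Let $d\ge1$. Assume that for some $1\leq\alpha,\beta,r\leq\infty$, $C>0$, the following estimate holds: $$\|e^{it\Delta}u_0\|_{W(L^\alpha,L^\beta)_tW(\mathcal FL^{r'},L^r)_x}\leq C\|u_0\|_{L^2_x}\quad\text{for all }u_0\in\mathcal S(\mathbb R^d).$$ Then $r\geq2$. Moreover, if $q$ is defined by the scaling relation $\frac2q+\frac dr=\frac d2$, then $$\alpha\leq\frac q2\qquad\text{and}\qquad\beta\geq q.$$
   Context: $p'$ denotes the conjugate exponent of $p$, and $1/\infty=0$. $e^{it\Delta}$ is the Schr\"odinger propagator on $\mathbb R^d$ (solution operator of $i\partial_tu+\Delta u=0$), i.e. the Fourier multiplier with symbol $e^{-4\pi^2it|\xi|^2}$, where $\hat f(\xi)=\int f(x)e^{-2\pi ix\xi}dx$. $\mathcal FL^p$ is the space of tempered distributions $f$ with $\hat f\in L^p$, normed by $\|f\|_{\mathcal FL^p}=\|\hat f\|_{L^p}$. For $B=L^p$ or $B=\mathcal FL^p$ on $\mathbb R^n$, fix a window $g\in C_0^\infty(\mathbb R^n)$ with $\|g\|_{L^2}=1$, let $T_yg(x)=g(x-y)$, and let $W(B,L^q)$ be the space of $f$ locally in $B$ with $\|f\|_{W(B,L^q)}=\big\|y\mapsto\|f\,T_yg\|_B\big\|_{L^q}<\infty$. Different windows give equivalent norms. The mixed norm is $$\|F\|_{W(L^\alpha,L^\beta)_tW(\mathcal FL^{r'},L^r)_x}=\big\|\,\|F(t,\cdot)\|_{W(\mathcal FL^{r'},L^r)(\mathbb R^d)}\big\|_{W(L^\alpha,L^\beta)(\mathbb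 R)}.$$ *)

theory Defs
  imports "HOL-Probability.Probability"
begin

section \<open>Smooth functions, test functions, Schwartz functions\<close>

text \<open>Functions on \<open>\<real>\<^sup>n\<close> are functions on a Euclidean space; \<open>iter_partial [b\<^sub>1, \<dots>, b\<^sub>k] f\<close> is
  the iterated partial derivative in the directions \<open>b\<^sub>1, \<dots>, b\<^sub>k\<close>. It is meaningful only when all
  the intermediate derivatives exist, which \<open>smooth\<close> guarantees.\<close>

fun iter_partial :: "'a list \<Rightarrow> ('a::euclidean_space \<Rightarrow> complex) \<Rightarrow> 'a \<Rightarrow> complex" where
  "iter_partial [] f = f"
| "iter_partial (b # bs) f = (\<lambda>x. frechet_derivative (iter_partial bs f) (at x) b)"

definition smooth :: "('a::euclidean_space \<Rightarrow> complex) \<Rightarrow> bool" where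
  "smooth f \<longleftrightarrow> (\<forall>bs \<in> lists Basis. iter_partial bs f differentiable_on UNIV)"

definition test_function :: "('a::euclidean_space \<Rightarrow> complex) \<Rightarrow> bool" where
  "test_function g \<longleftrightarrow> smooth g \<and> compact (closure {x. g x \<noteq> 0})"

definition schwartz :: "('a::euclidean_space \<Rightarrow> complex) \<Rightarrow> bool" where
  "schwartz f \<longleftrightarrow> smooth f \<and>
    (\<forall>k::nat. \<forall>bs \<in> lists Basis. bounded (range (\<lambda>x. norm x ^ k *\<^sub>R iter_partial bs f x)))"

section \<open>Fourier transform and Schroedinger propagator\<close>

definition fourier :: "('a::euclidean_space \<Rightarrow> complex) \<Rightarrow> 'a \<Rightarrow> complex" where
  "fourier f \<xi> = (LINT x|lborel. f x * cis (- 2 * pi * (x \<bullet> \<xi>)))"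

definition inv_fourier :: "('a::euclidean_space \<Rightarrow> complex) \<Rightarrow> 'a \<Rightarrow> complex" where
  "inv_fourier h x = (LINT \<xi>|lborel. h \<xi> * cis (2 * pi * (x \<bullet> \<xi>)))"

definition schroedinger :: "real \<Rightarrow> ('a::euclidean_space \<Rightarrow> complex) \<Rightarrow> 'a \<Rightarrow> complex" where
  "schroedinger t u\<^sub>0 = inv_fourier (\<lambda>\<xi>. cis (- 4 * pi\<^sup>2 * t * (norm \<xi>)\<^sup>2) * fourier u\<^sub>0 \<xi>)"

section \<open>Lebesgue and Wiener amalgam norms\<close>

text \<open>Exponents range over \<open>[1, \<infinity>]\<close> and are extended nonnegative reals, so that \<open>1/\<infinity> = 0\<close> and
  \<open>1/0 = \<infinity>\<close>; in particular the conjugates of \<open>1\<close> and \<open>\<infinity>\<close> come out right.\<close>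

definition conj_exp :: "ennreal \<Rightarrow> ennreal" where
  "conj_exp p = 1 / (1 - 1 / p)"

text \<open>Powers with exponent \<open>a > 0\<close>, with \<open>\<infinity>\<^sup>a = \<infinity>\<close>.\<close>

definition ennpow :: "ennreal \<Rightarrow> real \<Rightarrow> ennreal" where
  "ennpow x a = (if x = \<top> then \<top> else ennreal (enn2real x powr a))"

text \<open>Norms take the value \<open>\<infinity>\<close> outside the respective space. To allow nested norms, the argument
  of \<open>Lp_norm\<close> is the modulus of the function in question, as an extended nonnegative function.\<close>

definition Lp_norm :: "ennreal \<Rightarrow> ('a::euclidean_space \<Rightarrow> ennreal) \<Rightarrow> ennreal" where
  "Lp_norm p F = (if p = \<top> then esssup lborel F
     else ennpow (\<integral>\<^sup>+ x. ennpow (F x) (enn2real p) \<partial>lborel) (1 / enn2real p))"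

definition modulus :: "('a \<Rightarrow> complex) \<Rightarrow> 'a \<Rightarrow> ennreal" where
  "modulus f x = ennreal (norm (f x))"

definition FLp_norm :: "ennreal \<Rightarrow> ('a::euclidean_space \<Rightarrow> complex) \<Rightarrow> ennreal" where
  "FLp_norm p f = Lp_norm p (modulus (fourier f))"

definition window :: "('a::euclidean_space \<Rightarrow> complex) \<Rightarrow> bool" where
  "window g \<longleftrightarrow> test_function g \<and> Lp_norm 2 (modulus g) = 1"

text \<open>The norms of \<open>W(L\<^sup>p, L\<^sup>q)\<close> and \<open>W(\<F>L\<^sup>p, L\<^sup>q)\<close> with respect to a window. The first one is
  again a function of the modulus. The second one is meant for locally integrable functions: the
  localized function is then integrable, and its distributional Fourier transform is \<open>fourier\<close>.\<close>

definition W_Lp_norm ::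
    "('a::euclidean_space \<Rightarrow> complex) \<Rightarrow> ennreal \<Rightarrow> ennreal \<Rightarrow> ('a \<Rightarrow> ennreal) \<Rightarrow> ennreal" where
  "W_Lp_norm g p q F = Lp_norm q (\<lambda>y. Lp_norm p (\<lambda>x. F x * modulus g (x - y)))"

definition W_FLp_norm ::
    "('a::euclidean_space \<Rightarrow> complex) \<Rightarrow> ennreal \<Rightarrow> ennreal \<Rightarrow> ('a \<Rightarrow> complex) \<Rightarrow> ennreal" where
  "W_FLp_norm g p q f = Lp_norm q (\<lambda>y. FLp_norm p (\<lambda>x. f x * g (x - y)))"

text \<open>The norm of \<open>W(L\<^sup>\<alpha>, L\<^sup>\<beta>)\<^sub>t W(\<F>L\<^sup>p, L\<^sup>r)\<^sub>x\<close>, with time window \<open>h\<close> and space window \<open>g\<close>.\<close>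

definition mixed_norm ::
    "(real \<Rightarrow> complex) \<Rightarrow> ('a::euclidean_space \<Rightarrow> complex) \<Rightarrow>
      ennreal \<Rightarrow> ennreal \<Rightarrow> ennreal \<Rightarrow> ennreal \<Rightarrow> (real \<Rightarrow> 'a \<Rightarrow> complex) \<Rightarrow> ennreal" where
  "mixed_norm h g \<alpha> \<beta> p r F = W_Lp_norm h \<alpha> \<beta> (\<lambda>t. W_FLp_norm g p r (F t))"

end

theory Submission
  imports Defs
begin

text \<open>The estimate is tested on the Gaussians \<open>exp (- \<pi> b |x|\<^sup>2)\<close>. Write \<open>d\<close> for the dimension and
  \<open>N\<^sub>\<sigma>\<close> for the normalized Gaussian of width \<open>\<surd>\<sigma>\<close>. The right-hand side is a multiple of
  \<open>b powr (- d / 4)\<close>, the Fourier transform of the initial datum is \<open>N\<^sub>b\<close>, and comparing powers of \<open>b\<close>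
  in the two limits gives the two inequalities that carry the result.

  \<^item> As \<open>b \<rightarrow> \<infinity>\<close> the datum lives at scale \<open>1 / \<surd>b\<close> and has frequencies of size \<open>\<surd>b\<close>. As long as
  \<open>|t|\<close> is at most a small multiple of \<open>1 / \<surd>b\<close> the solution stays inside one window, although it
  has spread far beyond its initial width. Cutting off then does not change the order of
  magnitude of the \<open>\<F>L\<^sup>p\<close> norm with \<open>p = r'\<close>, which is that of the
  \<open>L\<^sup>p\<close> norm of \<open>N\<^sub>b\<close>, namely \<open>b powr (- d / (2 r))\<close>. The time
  interval contributes \<open>b powr (- 1 / (2 \<alpha>))\<close>. Hence \<open>d / r + 1 / \<alpha> \<ge> d / 2\<close>, which is \<open>\<alpha> \<le> q / 2\<close>
  (\<open>high_frequency_condition\<close>).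

  \<^item> As \<open>b \<rightarrow> 0\<close> the solution is close to \<open>1\<close> for \<open>|x|\<^sup>2\<close> and \<open>|t|\<close> up to a small multiple of \<open>1 / b\<close>, so
  every window in this region sees a fixed amount of it. The region contributes
  \<open>b powr (- d / (2 r) - 1 / \<beta>)\<close>. Hence \<open>d / r + 2 / \<beta> \<le> d / 2\<close>, which gives both \<open>r \<ge> 2\<close> and
  \<open>\<beta> \<ge> q\<close> (\<open>low_frequency_condition\<close>).

  Lower bounds on \<open>\<F>L\<^sup>p\<close> norms come from duality (\<open>FLp_norm_ge_pairing\<close>): if \<open>|\<psi>| \<le> M\<close> and
  \<open>\<psi>\<close> has total mass one, then pairing \<open>F\<close> with the Fourier transform of \<open>\<psi>\<close> gives at most
  \<open>M powr (1 / p)\<close> times the \<open>\<F>L\<^sup>p\<close> norm of \<open>F\<close>. For large \<open>b\<close> the function \<open>\<psi>\<close> is the conjugate of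
  the Fourier transform of the solution \<open>u\<close>, so that the pairing is the integral of \<open>|u|\<^sup>2\<close> against
  the window. Here \<open>|u|\<^sup>2\<close> is an explicit real Gaussian (\<open>norm_schroedinger_gaussian_squared\<close>), and
  concentration at a point where the window does not vanish bounds the integral from below.
  For small \<open>b\<close> the function \<open>\<psi>\<close> is a fixed Gaussian modulated so that its transform sits at such a
  point.\<close>

section \<open>Lower bounds for Lebesgue norms\<close>

lemma ennpow_ennreal: "0 \<le> x \<Longrightarrow> ennpow (ennreal x) a = ennreal (x powr a)"
  by (simp add: ennpow_def)

lemma ennpow_mono: "0 \<le> a \<Longrightarrow> x \<le> y \<Longrightarrow> ennpow x a \<le> ennpow y a"
  unfolding ennpow_def
  by (auto simp: top_unique intro!: ennreal_leI powr_mono2 enn2real_mono simp: less_top)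

lemma measurable_ennpow [measurable]: "(\<lambda>x. ennpow x a) \<in> borel_measurable borel"
  unfolding ennpow_def by measurable

text \<open>The functions to which this is applied are themselves norms, depending on a point or on a time,
  so \<open>F\<close> is arbitrary: the integral of a nonmeasurable function is the supremum over simple functions
  below it, and its essential supremum is \<open>\<top>\<close>. In the bound \<open>enn2real (1 / p)\<close> is \<open>0\<close> for \<open>p = \<top>\<close>, so
  both kinds of exponents have the same form.\<close>

lemma Lp_norm_ge_on_set:
  assumes S: "S \<in> sets borel" "emeasure lborel S = ennreal m" "0 < m"
    and c: "0 \<le> c" and F: "\<And>x. x \<in> S \<Longrightarrow> ennreal c \<le> F x" and p: "1 \<le> p"
  shows "ennreal (c * m powr enn2real (1 / p)) \<le> Lp_norm p F"
proof (cases "p = \<top>")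
  case True
  have "ennreal c \<le> esssup lborel F"
  proof (rule ccontr)
    assume "\<not> ennreal c \<le> esssup lborel F"
    then have "S \<subseteq> {x \<in> space lborel. F x > esssup lborel F}"
      using F by (auto simp: not_le intro: less_le_trans)
    moreover have "esssup lborel F \<noteq> \<top>"
      using \<open>\<not> ennreal c \<le> esssup lborel F\<close> by auto
    then have "F \<in> borel_measurable lborel"
      using esssup_non_measurable by blast
    ultimately have "emeasure lborel S \<le> emeasure lborel {x \<in> space lborel. F x > esssup lborel F}"
      by (intro emeasure_mono) auto
    then show False using S esssup_zero_measure[of lborel F] by auto
  qed
  then show ?thesis using True S by (simp add: Lp_norm_def)
next
  case False
  define P where "P = enn2real p"
  have pP: "p = ennreal P" using False by (simp add: P_def less_top)
  have "1 \<le> P" using p unfolding pP by simp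
  have iP: "enn2real (1 / p) = 1 / P"
    using \<open>1 \<le> P\<close> by (simp add: pP ennreal_1[symmetric] divide_ennreal del: ennreal_1)
  have "ennreal (c powr P * m) = (\<integral>\<^sup>+x. ennreal (c powr P) * indicator S x \<partial>lborel)"
    using S by (simp add: nn_integral_cmult_indicator ennreal_mult)
  also have "\<dots> \<le> (\<integral>\<^sup>+x. ennpow (F x) P \<partial>lborel)"
    using ennpow_mono[of P "ennreal c"] F \<open>1 \<le> P\<close> c
    by (intro nn_integral_mono) (auto simp: ennpow_ennreal split: split_indicator)
  finally have "ennpow (ennreal (c powr P * m)) (1 / P) \<le> Lp_norm p F"
    using False \<open>1 \<le> P\<close> unfolding Lp_norm_def P_def[symmetric] by (auto intro!: ennpow_mono)
  moreover have "ennpow (ennreal (c powr P * m)) (1 / P) = ennreal (c * m powr (1 / P))"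
    using c S \<open>1 \<le> P\<close> by (simp add: ennpow_ennreal powr_mult powr_powr)
  ultimately show ?thesis unfolding iP by simp
qed

text \<open>The convex function \<open>v powr P\<close> lies above its tangent at \<open>A\<close>.\<close>

lemma powr_tangent:
  assumes "0 \<le> v" "0 < A" "1 \<le> P"
  shows "P * A powr (P - 1) * v \<le> v powr P + (P - 1) * A powr (P::real)"
proof (cases "v = 0")
  case True then show ?thesis using assms by auto
next
  case False
  have "(v powr P) powr (1 / P) * (A powr P) powr (1 - 1 / P)
      \<le> 1 / P * v powr P + (1 - 1 / P) * A powr P"
    by (rule Youngs_inequality_0) (use False assms in \<open>auto simp: field_simps\<close>)
  also have "(A powr P) powr (1 - 1 / P) = A powr (P - 1)"
    using assms by (simp add: powr_powr right_diff_distrib)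
  also have "(v powr P) powr (1 / P) = v"
    using assms by (simp add: powr_powr)
  finally have "P * (v * A powr (P - 1)) \<le> P * (1 / P * v powr P + (1 - 1 / P) * A powr P)"
    using assms by (intro mult_left_mono) auto
  also have "\<dots> = v powr P + (P - 1) * A powr P"
    using assms by (simp add: field_simps)
  finally show ?thesis by (simp add: mult_ac)
qed

text \<open>This is Hoelder's inequality \<open>\<integral> X w \<le> \<parallel>X\<parallel>\<^sub>p \<parallel>w\<parallel>\<^sub>p\<^sub>'\<close> combined with \<open>\<parallel>w\<parallel>\<^sub>p\<^sub>' \<le> M powr (1 / p)\<close>,
  which holds because \<open>w\<close> has mass one and is bounded by \<open>M\<close>. For finite \<open>p\<close> it is proved as Jensen's
  inequality: integrating the tangent of \<open>v powr p\<close> at \<open>v = A\<close> against the probability density \<open>w\<close>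
  bounds \<open>A powr p\<close> by the integral of \<open>X powr p\<close> against \<open>w\<close>.\<close>

lemma weighted_integral_le_Lp_norm:
  assumes [measurable]: "X \<in> borel_measurable borel" "w \<in> borel_measurable borel"
    and w: "\<And>x. 0 \<le> w x" "\<And>x. w x \<le> M" "(\<integral>\<^sup>+x. ennreal (w x) \<partial>lborel) = 1"
    and p: "1 \<le> p" and A: "ennreal A \<le> (\<integral>\<^sup>+x. X x * ennreal (w x) \<partial>lborel)"
  shows "ennreal A \<le> ennreal (M powr enn2real (1 / p)) * Lp_norm p X"
proof (cases "A \<le> 0 \<or> p = \<top>")
  case True
  show ?thesis
  proof (cases "A \<le> 0")
    case True
    then show ?thesis by (simp add: ennreal_neg)
  next
    case False
    with \<open>A \<le> 0 \<or> p = \<top>\<close> have pt: "p = \<top>" by simp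
    have "0 < M"
    proof (rule ccontr)
      assume "\<not> 0 < M"
      then have "w x = 0" for x using w(1,2)[of x] by linarith
      then show False using w(3) by simp
    qed
    have "ennreal A \<le> (\<integral>\<^sup>+x. esssup lborel X * ennreal (w x) \<partial>lborel)"
      using esssup_AE[where M=lborel and f=X]
      by (intro order_trans[OF A] nn_integral_mono_AE) (auto intro!: mult_right_mono)
    also have "\<dots> = esssup lborel X"
      using w(3) by (simp add: nn_integral_cmult)
    finally show ?thesis using \<open>0 < M\<close> pt by (simp add: Lp_norm_def)
  qed
next
  case False
  then have "0 < A" by simp
  define P where "P = enn2real p"
  have pP: "p = ennreal P" using False by (simp add: P_def less_top)
  have "1 \<le> P" using p unfolding pP by simp
  have iP: "enn2real (1 / p) = 1 / P"
    using \<open>1 \<le> P\<close> by (simp add: pP ennreal_1[symmetric] divide_ennreal del: ennreal_1)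
  have M: "0 \<le> M" using w(1,2) order_trans by blast
  define I where "I = (\<integral>\<^sup>+x. ennpow (X x) P \<partial>lborel)"
  have pt: "ennreal (P * A powr (P - 1)) * X x \<le> ennpow (X x) P + ennreal ((P - 1) * A powr P)" for x
  proof (cases "X x")
    case (real v)
    then show ?thesis
      using powr_tangent[of v A P] \<open>0 < A\<close> \<open>1 \<le> P\<close>
      by (simp add: ennpow_ennreal ennreal_mult[symmetric] ennreal_plus[symmetric] ennreal_leI del: ennreal_plus)
  qed (simp add: ennpow_def)
  have "ennreal (P * A powr P) = ennreal (P * A powr (P - 1)) * ennreal A"
    using \<open>0 < A\<close> \<open>1 \<le> P\<close> by (simp add: ennreal_mult[symmetric] powr_diff)
  also have "\<dots> \<le> ennreal (P * A powr (P - 1)) * (\<integral>\<^sup>+x. X x * ennreal (w x) \<partial>lborel)"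
    by (intro mult_left_mono A) simp
  also have "\<dots> = (\<integral>\<^sup>+x. ennreal (P * A powr (P - 1)) * X x * ennreal (w x) \<partial>lborel)"
    by (simp add: nn_integral_cmult mult.assoc)
  also have "\<dots> \<le> (\<integral>\<^sup>+x. ennreal M * ennpow (X x) P + ennreal ((P - 1) * A powr P) * ennreal (w x) \<partial>lborel)"
  proof (intro nn_integral_mono)
    fix x
    have "ennreal (P * A powr (P - 1)) * X x * ennreal (w x)
        \<le> (ennpow (X x) P + ennreal ((P - 1) * A powr P)) * ennreal (w x)"
      by (intro mult_right_mono pt) simp
    also have "\<dots> = ennreal (w x) * ennpow (X x) P + ennreal ((P - 1) * A powr P) * ennreal (w x)"
      by (simp add: distrib_left mult.commute)
    also have "\<dots> \<le> ennreal M * ennpow (X x) P + ennreal ((P - 1) * A powr P) * ennreal (w x)"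
      using w(2)[of x] by (intro add_right_mono mult_right_mono ennreal_leI) auto
    finally show "ennreal (P * A powr (P - 1)) * X x * ennreal (w x) \<le> \<dots>" .
  qed
  also have "\<dots> = ennreal M * I + ennreal ((P - 1) * A powr P)"
    unfolding I_def using w(3) by (simp add: nn_integral_add nn_integral_cmult)
  finally have *: "ennreal (P * A powr P) \<le> ennreal M * I + ennreal ((P - 1) * A powr P)" .
  have "P * A powr P = A powr P + (P - 1) * A powr P" by (simp add: algebra_simps)
  then have "ennreal (P * A powr P) = ennreal (A powr P) + ennreal ((P - 1) * A powr P)"
    using \<open>1 \<le> P\<close> by (simp add: ennreal_plus[symmetric] del: ennreal_plus)
  with * have **: "ennreal (A powr P) \<le> ennreal M * I"
    by (simp add: ennreal_add_left_cancel_le add.commute)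
  have "ennreal A = ennpow (ennreal (A powr P)) (1 / P)"
    using \<open>0 < A\<close> \<open>1 \<le> P\<close> by (simp add: ennpow_ennreal powr_powr)
  also have "\<dots> \<le> ennpow (ennreal M * I) (1 / P)"
    using \<open>1 \<le> P\<close> by (intro ennpow_mono **) simp
  also have "\<dots> = ennreal (M powr (1 / P)) * ennpow I (1 / P)"
  proof (cases I)
    case (real v)
    then show ?thesis using M by (simp add: ennpow_ennreal ennreal_mult[symmetric] powr_mult)
  next
    case top
    moreover have "0 < M" using M ** \<open>0 < A\<close> by (cases "M = 0") auto
    ultimately show ?thesis by (simp add: ennpow_def ennreal_mult_top)
  qed
  also have "\<dots> = ennreal (M powr enn2real (1 / p)) * Lp_norm p X"
    using False by (simp add: iP Lp_norm_def I_def P_def)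
  finally show ?thesis .
qed

section \<open>Real Gaussians\<close>

text \<open>The normalization makes the integral \<open>1\<close>; the Fourier transform is then \<open>exp (- \<pi> \<sigma> |\<xi>|\<^sup>2)\<close>.\<close>

definition gauss_kernel :: "real \<Rightarrow> 'a::euclidean_space \<Rightarrow> real" where
  "gauss_kernel \<sigma> x = \<sigma> powr (- real DIM('a) / 2) * exp (- pi * (norm x)\<^sup>2 / \<sigma>)"

lemma gauss_kernel_nonneg [simp]: "0 \<le> gauss_kernel \<sigma> x"
  by (simp add: gauss_kernel_def)

lemma measurable_gauss_kernel [measurable]: "gauss_kernel \<sigma> \<in> borel_measurable borel"
  unfolding gauss_kernel_def by measurable

lemma measurable_cis [measurable]: "cis \<in> borel_measurable borel"
  by (intro borel_measurable_continuous_onI continuous_intros)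

lemma integral_lborel_prod:
  fixes f :: "'a::euclidean_space \<Rightarrow> real \<Rightarrow> complex"
  assumes "\<And>b. b \<in> Basis \<Longrightarrow> integrable lborel (f b)"
  shows "(LINT x|lborel. (\<Prod>b\<in>Basis. f b (x \<bullet> b))) = (\<Prod>b\<in>Basis. LINT x|lborel. f b x)"
    and "integrable lborel (\<lambda>x. (\<Prod>b\<in>Basis. f b (x \<bullet> b)))"
proof -
  have [measurable]: "b \<in> Basis \<Longrightarrow> f b \<in> borel_measurable borel" for b
    using assms by (simp add: borel_measurable_integrable)
  interpret product_sigma_finite "\<lambda>_::'a. lborel :: real measure" ..
  have eq: "(\<Prod>b\<in>Basis. f b ((\<Sum>j\<in>Basis. x j *\<^sub>R j) \<bullet> b)) = (\<Prod>b\<in>Basis. f b (x b))" for x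
    by (intro prod.cong refl) simp
  have m: "(\<lambda>f. \<Sum>b\<in>Basis. f b *\<^sub>R b) \<in> (\<Pi>\<^sub>M b\<in>Basis. lborel) \<rightarrow>\<^sub>M (borel :: 'a measure)"
    by measurable
  have m2: "(\<lambda>x::'a. (\<Prod>b\<in>Basis. f b (x \<bullet> b))) \<in> borel_measurable borel"
    by measurable
  show "(LINT x|lborel. (\<Prod>b\<in>Basis. f b (x \<bullet> b))) = (\<Prod>b\<in>Basis. LINT x|lborel. f b x)"
    apply (subst (1) lborel_eq)
    apply (subst integral_distr[OF m m2])
    unfolding eq
    apply (rule product_integral_prod)
    using assms by auto
  show "integrable lborel (\<lambda>x. (\<Prod>b\<in>Basis. f b (x \<bullet> b)))"
    apply (subst (1) lborel_eq)
    apply (subst integrable_distr_eq[OF m m2])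
    unfolding eq
    apply (rule product_integrable_prod)
    using assms by auto
qed

text \<open>The substitution \<open>x = s y\<close> with \<open>s\<^sup>2 = \<sigma> / (2 \<pi>)\<close> turns the integral into the characteristic function
  of the standard normal distribution.\<close>

lemma gaussian_fourier_1d:
  assumes "0 < \<sigma>"
  shows "(LINT x|lborel. complex_of_real (exp (- pi * x\<^sup>2 / \<sigma>)) * cis (2 * pi * (x * \<xi>)))
     = complex_of_real (sqrt \<sigma> * exp (- pi * \<sigma> * \<xi>\<^sup>2))" (is "?L = ?R")
    and "integrable lborel (\<lambda>x. complex_of_real (exp (- pi * x\<^sup>2 / \<sigma>)) * cis (2 * pi * (x * \<xi>)))"
proof -
  define s where "s = sqrt (\<sigma> / (2 * pi))"
  have s: "0 < s" "s\<^sup>2 = \<sigma> / (2 * pi)" using assms by (auto simp: s_def)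
  have e: "exp (- pi * (s * x)\<^sup>2 / \<sigma>) = exp (- (x\<^sup>2) / 2)" for x
    using s assms by (simp add: power_mult_distrib field_simps)
  let ?g = "\<lambda>x. complex_of_real (exp (- pi * x\<^sup>2 / \<sigma>)) * cis (2 * pi * (x * \<xi>))"
  define t where "t = 2 * pi * s * \<xi>"
  have eq: "?g (s * x) = sqrt (2 * pi) *\<^sub>R (std_normal_density x *\<^sub>R cis (t * x))" for x
    unfolding e by (simp add: std_normal_density_def t_def scaleR_conv_of_real mult_ac)
  have ch: "(LINT x|lborel. std_normal_density x *\<^sub>R cis (t * x)) = complex_of_real (exp (- (t\<^sup>2) / 2))"
    using fun_cong[OF char_std_normal_distribution, of t] unfolding char_def cis_conv_exp
    by (subst (asm) integral_density) (auto simp: normal_density_nonneg)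
  have i0: "integrable lborel (\<lambda>x. std_normal_density x *\<^sub>R cis (t * x))"
    by (rule Bochner_Integration.integrable_bound[OF integrable_std_normal_moment[of 0]]) (auto simp: normal_density_nonneg)
  have ig: "integrable lborel (\<lambda>x. ?g (0 + s * x))"
    unfolding add_0 eq by (intro integrable_scaleR_right i0)
  show "integrable lborel ?g"
    using lborel_integrable_real_affine_iff[of s ?g 0] s ig by simp
  have "?L = \<bar>s\<bar> *\<^sub>R (LINT x|lborel. ?g (0 + s * x))"
    by (rule lborel_integral_real_affine) (use s in auto)
  also have "\<dots> = s *\<^sub>R (sqrt (2 * pi) *\<^sub>R complex_of_real (exp (- (t\<^sup>2) / 2)))"
    unfolding add_0 eq integral_scaleR_right ch using s by simp
  also have "t\<^sup>2 / 2 = pi * \<sigma> * \<xi>\<^sup>2"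
    using s by (simp add: t_def power_mult_distrib power2_eq_square)
  then have "- t\<^sup>2 / 2 = - pi * \<sigma> * \<xi>\<^sup>2" by simp
  also have "s *\<^sub>R (sqrt (2 * pi) *\<^sub>R complex_of_real (exp (- pi * \<sigma> * \<xi>\<^sup>2))) = ?R"
    using assms by (simp add: s_def scaleR_conv_of_real real_sqrt_divide)
  finally show "?L = ?R" .
qed

lemma power2_norm_eq_sum: "(norm (x::'a::euclidean_space))\<^sup>2 = (\<Sum>b\<in>Basis. (x \<bullet> b)\<^sup>2)"
  unfolding power2_norm_eq_inner by (subst euclidean_inner) (simp add: power2_eq_square)

lemma gaussian_wave_prod:
  fixes x \<xi> :: "'a::euclidean_space"
  shows "complex_of_real (exp (- pi * (norm x)\<^sup>2 / \<sigma>)) * cis (2 * pi * (x \<bullet> \<xi>))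
    = (\<Prod>b\<in>Basis. complex_of_real (exp (- pi * (x \<bullet> b)\<^sup>2 / \<sigma>)) * cis (2 * pi * ((x \<bullet> b) * (\<xi> \<bullet> b))))"
proof -
  have "exp (- pi * (norm x)\<^sup>2 / \<sigma>) = (\<Prod>b\<in>Basis. exp (- pi * (x \<bullet> b)\<^sup>2 / \<sigma>))"
    by (subst exp_sum[symmetric]) (simp_all add: power2_norm_eq_sum sum_distrib_left sum_divide_distrib sum_negf)
  moreover have "cis (2 * pi * (x \<bullet> \<xi>)) = (\<Prod>b\<in>Basis. cis (2 * pi * ((x \<bullet> b) * (\<xi> \<bullet> b))))"
    unfolding cis_conv_exp
    by (subst exp_sum[symmetric]) (simp_all add: euclidean_inner[of x \<xi>] sum_distrib_left)
  ultimately show ?thesis by (simp add: prod.distrib)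
qed

lemma
  fixes \<xi> :: "'a::euclidean_space"
  assumes "0 < \<sigma>"
  shows gauss_kernel_fourier:
      "(LINT x|lborel. complex_of_real (gauss_kernel \<sigma> x) * cis (2 * pi * (x \<bullet> \<xi>)))
        = complex_of_real (exp (- pi * \<sigma> * (norm \<xi>)\<^sup>2))"
    and integrable_gauss_kernel_cis:
      "integrable lborel (\<lambda>x. complex_of_real (gauss_kernel \<sigma> x) * cis (2 * pi * (x \<bullet> \<xi>)))"
proof -
  let ?f = "\<lambda>b x. complex_of_real (exp (- pi * x\<^sup>2 / \<sigma>)) * cis (2 * pi * (x * (\<xi> \<bullet> b)))"
  let ?G = "\<lambda>x. complex_of_real (exp (- pi * (norm x)\<^sup>2 / \<sigma>)) * cis (2 * pi * (x \<bullet> \<xi>))"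
  have "(LINT x|lborel. ?G x) = (\<Prod>b\<in>Basis. (LINT x|lborel. ?f b x))"
    unfolding gaussian_wave_prod using assms
    by (intro integral_lborel_prod gaussian_fourier_1d)
  also have "\<dots> = complex_of_real (\<Prod>b\<in>Basis. sqrt \<sigma> * exp (- pi * \<sigma> * (\<xi> \<bullet> b)\<^sup>2))"
    unfolding of_real_prod using assms by (intro prod.cong refl gaussian_fourier_1d)
  also have "(\<Prod>b\<in>Basis. sqrt \<sigma> * exp (- pi * \<sigma> * (\<xi> \<bullet> b)\<^sup>2)) =
      sqrt \<sigma> ^ DIM('a) * exp (- pi * \<sigma> * (norm \<xi>)\<^sup>2)"
    by (simp add: prod.distrib exp_sum[symmetric] power2_norm_eq_sum sum_distrib_left sum_negf)
  also have "sqrt \<sigma> ^ DIM('a) = \<sigma> powr (real DIM('a) / 2)"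
    using assms by (simp add: powr_half_sqrt[symmetric] powr_realpow[symmetric] powr_powr)
  finally have 1: "(LINT x|lborel. ?G x) = complex_of_real (\<sigma> powr (real DIM('a) / 2) * exp (- pi * \<sigma> * (norm \<xi>)\<^sup>2))" .
  have eq: "(\<lambda>x. complex_of_real (gauss_kernel \<sigma> x) * cis (2 * pi * (x \<bullet> \<xi>)))
    = (\<lambda>x. complex_of_real (\<sigma> powr (- real DIM('a) / 2)) * ?G x)"
    by (simp add: gauss_kernel_def mult_ac)
  have 2: "integrable lborel ?G"
    unfolding gaussian_wave_prod using assms
    by (intro integral_lborel_prod gaussian_fourier_1d)
  show "integrable lborel (\<lambda>x. complex_of_real (gauss_kernel \<sigma> x) * cis (2 * pi * (x \<bullet> \<xi>)))"
    unfolding eq by (intro integrable_mult_right 2)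
  show "(LINT x|lborel. complex_of_real (gauss_kernel \<sigma> x) * cis (2 * pi * (x \<bullet> \<xi>)))
        = complex_of_real (exp (- pi * \<sigma> * (norm \<xi>)\<^sup>2))"
    unfolding eq integral_mult_right_zero 1
    by (simp only: of_real_mult[symmetric] mult.assoc[symmetric]) (use assms in \<open>simp add: powr_add[symmetric]\<close>)
qed

lemma integrable_gauss_kernel [intro, simp]:
  assumes "0 < \<sigma>" shows "integrable lborel (gauss_kernel \<sigma> :: 'a::euclidean_space \<Rightarrow> real)"
  using integrable_Re[OF integrable_gauss_kernel_cis[OF assms, of "0::'a"]] by simp

lemma integral_gauss_kernel:
  assumes "0 < \<sigma>" shows "(LINT x|lborel. gauss_kernel \<sigma> (x :: 'a::euclidean_space)) = 1"
  using gauss_kernel_fourier[OF assms, of "0::'a"]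
  by (metis (no_types, lifting) cis_zero exp_zero inner_zero_right integral_complex_of_real mult.right_neutral mult_zero_right norm_zero of_real_eq_iff power_zero_numeral ext)

lemma nn_integral_gauss_kernel:
  assumes "0 < \<sigma>" shows "(\<integral>\<^sup>+x. ennreal (gauss_kernel \<sigma> (x :: 'a::euclidean_space)) \<partial>lborel) = 1"
  using assms by (subst nn_integral_eq_integral) (auto simp: integral_gauss_kernel)

text \<open>Trading half of the exponent for the factor \<open>|x|\<^sup>2\<close>, by \<open>u \<le> exp u\<close>, bounds the second moment by the
  mass of a Gaussian of twice the variance.\<close>

lemma gauss_kernel_second_moment_pointwise:
  assumes "0 < \<sigma>"
  shows "gauss_kernel \<sigma> x * (norm x)\<^sup>2
    \<le> 2 * \<sigma> / pi * 2 powr (real DIM('a) / 2) * gauss_kernel (2 * \<sigma>) (x :: 'a::euclidean_space)"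
proof -
  define u where "u = pi * (norm x)\<^sup>2 / (2 * \<sigma>)"
  have "u \<le> exp u" using exp_ge_add_one_self[of u] by linarith
  have n: "(norm x)\<^sup>2 = 2 * \<sigma> / pi * u" using assms by (simp add: u_def)
  have "exp (- (2 * u)) * u \<le> exp (- (2 * u)) * exp u"
    by (intro mult_left_mono \<open>u \<le> exp u\<close>) simp
  also have "\<dots> = exp (- u)" by (simp add: exp_add[symmetric])
  finally have e: "exp (- (2 * u)) * u \<le> exp (- u)" .
  have g1: "gauss_kernel \<sigma> x = \<sigma> powr (- real DIM('a) / 2) * exp (- (2 * u))"
    using assms by (simp add: gauss_kernel_def u_def)
  have g2: "gauss_kernel (2 * \<sigma>) x = 2 powr (- real DIM('a) / 2) * \<sigma> powr (- real DIM('a) / 2) * exp (- u)"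
    using assms by (simp add: gauss_kernel_def u_def powr_mult)
  have "2 powr (real DIM('a) / 2) * 2 powr (- real DIM('a) / 2) = (1::real)"
    by (simp add: powr_add[symmetric])
  moreover have rearrange: "a * b * (c * d * e) = (b * c) * (a * d * e)" for a b c d e :: real
    by simp
  ultimately have "2 * \<sigma> / pi * 2 powr (real DIM('a) / 2) * gauss_kernel (2 * \<sigma>) x
    = 2 * \<sigma> / pi * \<sigma> powr (- real DIM('a) / 2) * exp (- u)"
    unfolding g2 by (subst rearrange) simp
  moreover have "gauss_kernel \<sigma> x * (norm x)\<^sup>2 = 2 * \<sigma> / pi * \<sigma> powr (- real DIM('a) / 2) * (exp (- (2 * u)) * u)"
    unfolding g1 n by (simp add: mult_ac)
  moreover have "\<dots> \<le> 2 * \<sigma> / pi * \<sigma> powr (- real DIM('a) / 2) * exp (- u)"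
    using assms by (intro mult_left_mono e) auto
  ultimately show ?thesis by (simp only:)
qed

definition moment_const :: "'a::euclidean_space itself \<Rightarrow> real" where
  "moment_const _ = 2 / pi * 2 powr (real DIM('a) / 2)"

lemma moment_const_pos [simp]: "0 < moment_const TYPE('a::euclidean_space)"
  and moment_const_nonneg [simp]: "0 \<le> moment_const TYPE('a::euclidean_space)"
  by (simp_all add: moment_const_def)

lemma
  assumes "0 < \<sigma>"
  shows integrable_gauss_kernel_moment:
      "integrable lborel (\<lambda>x::'a::euclidean_space. gauss_kernel \<sigma> x * (norm x)\<^sup>2)"
    and gauss_kernel_moment:
      "(LINT x|lborel. gauss_kernel \<sigma> (x::'a) * (norm x)\<^sup>2) \<le> moment_const TYPE('a) * \<sigma>"
proof -
  let ?c = "2 * \<sigma> / pi * 2 powr (real DIM('a) / 2)"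
  have i: "integrable lborel (\<lambda>x::'a. ?c * gauss_kernel (2 * \<sigma>) x)"
    using assms by (intro integrable_mult_right) auto
  show 1: "integrable lborel (\<lambda>x::'a. gauss_kernel \<sigma> x * (norm x)\<^sup>2)"
    by (rule Bochner_Integration.integrable_bound[OF i])
       (use order_trans[OF gauss_kernel_second_moment_pointwise[OF assms] abs_ge_self] in \<open>auto simp: abs_mult\<close>)
  have "(LINT x|lborel. gauss_kernel \<sigma> (x::'a) * (norm x)\<^sup>2) \<le> (LINT x|lborel. ?c * gauss_kernel (2 * \<sigma>) (x::'a))"
    by (intro integral_mono 1 i gauss_kernel_second_moment_pointwise assms)
  also have "\<dots> = ?c" using assms integral_gauss_kernel[of "2 * \<sigma>", where 'a='a] by simp
  finally show "(LINT x|lborel. gauss_kernel \<sigma> (x::'a) * (norm x)\<^sup>2) \<le> moment_const TYPE('a) * \<sigma>"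
    by (simp add: moment_const_def mult_ac)
qed

lemma integrable_gauss_kernel_mult:
  fixes f :: "'a::euclidean_space \<Rightarrow> complex"
  assumes "0 < \<sigma>" and [measurable]: "f \<in> borel_measurable borel" and "\<And>x. norm (f x) \<le> B"
  shows "integrable lborel (\<lambda>x. complex_of_real (gauss_kernel \<sigma> x) * f x)"
proof (rule Bochner_Integration.integrable_bound)
  show "integrable lborel (\<lambda>x::'a. B * gauss_kernel \<sigma> x)"
    using assms(1) by (intro integrable_mult_right) auto
  show "AE x in lborel. norm (complex_of_real (gauss_kernel \<sigma> x) * f x) \<le> norm (B * gauss_kernel \<sigma> x)"
  proof (rule AE_I2)
    fix x
    have "norm (complex_of_real (gauss_kernel \<sigma> x) * f x) \<le> gauss_kernel \<sigma> x * B"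
      using mult_left_mono[OF assms(3)[of x] gauss_kernel_nonneg[of \<sigma> x]] by (simp add: norm_mult)
    also have "\<dots> \<le> norm (B * gauss_kernel \<sigma> x)" by (simp add: mult.commute[of B] abs_ge_self)
    finally show "norm (complex_of_real (gauss_kernel \<sigma> x) * f x) \<le> norm (B * gauss_kernel \<sigma> x)" .
  qed
qed measurable

text \<open>The kernels approximate the identity, uniformly for centers near \<open>y0\<close>: outside a small ball
  the variation of \<open>g\<close> is at most \<open>2 B\<close>, which is dominated there by a multiple of \<open>|x|\<^sup>2\<close>, and the
  second moment of the kernel is small.\<close>

lemma gauss_kernel_concentrates:
  fixes g :: "'a::euclidean_space \<Rightarrow> complex"
  assumes cont: "continuous_on UNIV g" and B: "\<And>x. norm (g x) \<le> B" and nz: "g y0 \<noteq> 0"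
  obtains \<delta> \<sigma>0 where "0 < \<delta>" "0 < \<sigma>0"
    "\<And>y \<sigma>. dist y y0 < \<delta> \<Longrightarrow> 0 < \<sigma> \<Longrightarrow> \<sigma> \<le> \<sigma>0 \<Longrightarrow>
      norm (g y0) / 2 \<le> norm (LINT x|lborel. complex_of_real (gauss_kernel \<sigma> x) * g (x + y))"
proof -
  define c where "c = norm (g y0)"
  have "0 < c" using nz by (simp add: c_def)
  have "0 < B" using less_le_trans[OF _ B[of y0], of 0] nz by simp
  have [measurable]: "g \<in> borel_measurable borel"
    by (rule borel_measurable_continuous_onI[OF cont])
  obtain \<delta> where \<delta>: "0 < \<delta>" "\<And>z. dist z y0 < \<delta> \<Longrightarrow> dist (g z) (g y0) < c / 4"
    using cont[unfolded continuous_on_iff, rule_format, of y0 "c / 4"] \<open>0 < c\<close> by auto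
  define r where "r = \<delta> / 2"
  have "0 < r" using \<delta> by (simp add: r_def)
  define K where "K = 2 * B / r\<^sup>2"
  have "0 < K" using \<open>0 < B\<close> \<open>0 < r\<close> by (simp add: K_def)
  \<comment> \<open>the width at which the second moment contributes at most \<open>c / 4\<close>\<close>
  define \<sigma>0 where "\<sigma>0 = c / (4 * K * moment_const TYPE('a))"
  have "0 < \<sigma>0" using \<open>0 < c\<close> \<open>0 < K\<close> by (simp add: \<sigma>0_def)
  have "c / 2 \<le> norm (LINT x|lborel. complex_of_real (gauss_kernel \<sigma> x) * g (x + y))"
    if y: "dist y y0 < r" and \<sigma>: "0 < \<sigma>" "\<sigma> \<le> \<sigma>0" for y \<sigma>
  proof -
    have i: "integrable lborel (\<lambda>x. complex_of_real (gauss_kernel \<sigma> x) * g (x + y))"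
      by (rule integrable_gauss_kernel_mult[where B=B]) (use B \<sigma> in auto)
    have i0: "integrable lborel (\<lambda>x::'a. complex_of_real (gauss_kernel \<sigma> x) * g y0)"
      using \<sigma> by (intro integrable_mult_left integrable_of_real) auto
    have I0: "(LINT x|lborel. complex_of_real (gauss_kernel \<sigma> (x::'a)) * g y0) = g y0"
      using integral_gauss_kernel[OF \<sigma>(1), where 'a='a] \<sigma> by simp
    have pt: "norm (g (x + y) - g y0) \<le> c / 4 + K * (norm x)\<^sup>2" for x
    proof (cases "norm x < r")
      case True
      have "dist (x + y) y0 \<le> norm x + dist y y0"
        using norm_triangle_ineq[of x "y - y0"] by (simp add: dist_norm algebra_simps)
      also have "\<dots> < \<delta>" using True y by (simp add: r_def)
      finally have "dist (g (x + y)) (g y0) < c / 4" by (rule \<delta>)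
      moreover have "0 \<le> K * (norm x)\<^sup>2" using \<open>0 < K\<close> by simp
      ultimately show ?thesis unfolding dist_norm by linarith
    next
      case False
      have "norm (g (x + y) - g y0) \<le> 2 * B"
        using norm_triangle_ineq4[of "g (x + y)" "g y0"] B[of "x + y"] B[of y0] by linarith
      also have "2 * B = K * r\<^sup>2" using \<open>0 < r\<close> by (simp add: K_def)
      also have "\<dots> \<le> K * (norm x)\<^sup>2"
        using False \<open>0 < r\<close> \<open>0 < K\<close> by (intro mult_left_mono power_mono) auto
      finally show ?thesis using \<open>0 < c\<close> by linarith
    qed
    have "norm ((LINT x|lborel. complex_of_real (gauss_kernel \<sigma> x) * g (x + y)) - g y0)
      = norm (LINT x|lborel. complex_of_real (gauss_kernel \<sigma> x) * (g (x + y) - g y0))"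
      using Bochner_Integration.integral_diff[OF i i0] unfolding I0 by (simp add: right_diff_distrib)
    also have "\<dots> \<le> (LINT x|lborel. gauss_kernel \<sigma> x * (c / 4) + K * (gauss_kernel \<sigma> x * (norm (x::'a))\<^sup>2))"
    proof (rule Bochner_Integration.integral_norm_bound_integral)
      show "integrable lborel (\<lambda>x. complex_of_real (gauss_kernel \<sigma> x) * (g (x + y) - g y0))"
        using Bochner_Integration.integrable_diff[OF i i0] by (simp add: right_diff_distrib)
      show "integrable lborel (\<lambda>x::'a. gauss_kernel \<sigma> x * (c / 4) + K * (gauss_kernel \<sigma> x * (norm x)\<^sup>2))"
        using \<sigma> by (intro Bochner_Integration.integrable_add integrable_mult_left integrable_mult_right integrable_gauss_kernel_moment) auto
      fix x :: 'a
      show "norm (complex_of_real (gauss_kernel \<sigma> x) * (g (x + y) - g y0)) \<le> gauss_kernel \<sigma> x * (c / 4) + K * (gauss_kernel \<sigma> x * (norm x)\<^sup>2)"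
        using mult_left_mono[OF pt[of x] gauss_kernel_nonneg[of \<sigma> x]]
        by (simp add: norm_mult distrib_left mult.left_commute)
    qed
    also have "\<dots> = c / 4 + K * (LINT x|lborel. gauss_kernel \<sigma> x * (norm (x::'a))\<^sup>2)"
      using \<sigma> integral_gauss_kernel[OF \<sigma>(1), where 'a='a]
      by (subst Bochner_Integration.integral_add) (auto intro!: integrable_gauss_kernel_moment)
    also have "\<dots> \<le> c / 4 + K * (moment_const TYPE('a) * \<sigma>0)"
      using \<sigma> \<open>0 < K\<close> moment_const_pos[where 'a='a]
      by (intro add_left_mono mult_left_mono order_trans[OF gauss_kernel_moment]) (auto intro!: mult_left_mono)
    also have "\<dots> = c / 2"
      using \<open>0 < K\<close> moment_const_pos[where 'a='a] by (simp add: \<sigma>0_def del: moment_const_pos)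
    finally show ?thesis
      using norm_triangle_ineq2[of "g y0" "LINT x|lborel. complex_of_real (gauss_kernel \<sigma> x) * g (x + y)"]
      by (simp add: c_def norm_minus_commute)
  qed
  then show thesis
    by (intro that[OF \<open>0 < r\<close> \<open>0 < \<sigma>0\<close>]) (simp add: c_def)
qed

section \<open>Duality for the Fourier transform\<close>

lemma measurable_fourier [measurable]:
  fixes f :: "'a::euclidean_space \<Rightarrow> complex"
  assumes [measurable]: "f \<in> borel_measurable borel"
  shows "fourier f \<in> borel_measurable borel"
  unfolding fourier_def by measurable

lemma integral_fourier_swap:
  fixes F \<psi> :: "'a::euclidean_space \<Rightarrow> complex"
  assumes F: "integrable lborel F" and \<psi>: "integrable lborel \<psi>"
  shows "(LINT x|lborel. F x * fourier \<psi> x) = (LINT \<xi>|lborel. fourier F \<xi> * \<psi> \<xi>)"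
proof -
  note [measurable] = borel_measurable_integrable[OF F, simplified] borel_measurable_integrable[OF \<psi>, simplified]
  let ?k = "\<lambda>(x, \<xi>). F x * \<psi> \<xi> * cis (- 2 * pi * (x \<bullet> \<xi>))"
  have i: "integrable (lborel \<Otimes>\<^sub>M lborel) ?k"
  proof (rule lborel_pair.Fubini_integrable)
    show "integrable lborel (\<lambda>x. LINT y|lborel. norm (?k (x, y)))"
      using F by (simp add: norm_mult)
    show "AE x in lborel. integrable lborel (\<lambda>y. ?k (x, y))"
    proof (rule AE_I2)
      fix x
      have "integrable lborel (\<lambda>y. F x * \<psi> y)" using \<psi> by simp
      then show "integrable lborel (\<lambda>y. ?k (x, y))"
        by (rule Bochner_Integration.integrable_bound) (auto simp: norm_mult)
    qed
  qed measurable
  have "(LINT x|lborel. F x * fourier \<psi> x) = (LINT x|lborel. LINT \<xi>|lborel. F x * \<psi> \<xi> * cis (- 2 * pi * (x \<bullet> \<xi>)))"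
    unfolding fourier_def integral_mult_right_zero[symmetric] by (simp add: mult.assoc inner_commute)
  also have "\<dots> = (LINT \<xi>|lborel. LINT x|lborel. F x * \<psi> \<xi> * cis (- 2 * pi * (x \<bullet> \<xi>)))"
    by (rule lborel_pair.Fubini_integral[symmetric, OF i])
  also have "\<dots> = (LINT \<xi>|lborel. fourier F \<xi> * \<psi> \<xi>)"
    unfolding fourier_def integral_mult_left_zero[symmetric] by (simp add: mult_ac)
  finally show ?thesis .
qed

text \<open>Every choice of \<open>\<psi>\<close> gives a lower bound for the \<open>\<F>L\<^sup>p\<close> norm.\<close>

lemma FLp_norm_ge_pairing:
  fixes F \<psi> :: "'a::euclidean_space \<Rightarrow> complex"
  assumes F: "integrable lborel F" and [measurable]: "\<psi> \<in> borel_measurable borel"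
    and \<psi>: "(\<integral>\<^sup>+\<xi>. ennreal (norm (\<psi> \<xi>)) \<partial>lborel) = 1" "\<And>\<xi>. norm (\<psi> \<xi>) \<le> M" and p: "1 \<le> p"
  shows "ennreal (norm (LINT x|lborel. F x * fourier \<psi> x))
    \<le> ennreal (M powr enn2real (1 / p)) * FLp_norm p F"
  unfolding FLp_norm_def
proof (rule weighted_integral_le_Lp_norm[where w="\<lambda>\<xi>. norm (\<psi> \<xi>)"])
  note [measurable] = borel_measurable_integrable[OF F, simplified]
  show "modulus (fourier F) \<in> borel_measurable borel"
    unfolding modulus_def by measurable
  have "integrable lborel \<psi>"
    using \<psi>(1) by (intro integrableI_bounded) auto
  then have "(LINT x|lborel. F x * fourier \<psi> x) = (LINT \<xi>|lborel. fourier F \<xi> * \<psi> \<xi>)"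
    by (rule integral_fourier_swap[OF F])
  then show "ennreal (norm (LINT x|lborel. F x * fourier \<psi> x))
    \<le> (\<integral>\<^sup>+ \<xi>. modulus (fourier F) \<xi> * ennreal (norm (\<psi> \<xi>)) \<partial>lborel)"
    using integral_norm_bound_ennreal[of lborel "\<lambda>\<xi>. fourier F \<xi> * \<psi> \<xi>"]
    unfolding modulus_def
    by (cases "integrable lborel (\<lambda>\<xi>. fourier F \<xi> * \<psi> \<xi>)")
       (simp_all add: norm_mult ennreal_mult not_integrable_integral_eq)
qed (use \<psi> p in auto)

section \<open>Solutions with Gaussian initial data\<close>

definition gaussian :: "real \<Rightarrow> 'a::euclidean_space \<Rightarrow> complex" where
  "gaussian b x = complex_of_real (exp (- pi * b * (norm x)\<^sup>2))"

lemma gaussian_eq_gauss_kernel: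
  assumes "0 < b"
  shows "gaussian b (x::'a::euclidean_space)
    = complex_of_real (b powr (- real DIM('a) / 2)) * complex_of_real (gauss_kernel (1 / b) x)"
proof -
  have "b powr (- real DIM('a) / 2) * gauss_kernel (1 / b) x
      = (b powr (- real DIM('a) / 2) * (1 / b) powr (- real DIM('a) / 2)) * exp (- pi * b * (norm x)\<^sup>2)"
    by (simp add: gauss_kernel_def mult_ac)
  also have "b powr (- real DIM('a) / 2) * (1 / b) powr (- real DIM('a) / 2) = 1"
    using assms by (subst powr_mult[symmetric]) auto
  finally show ?thesis unfolding gaussian_def of_real_mult[symmetric] by simp
qed

lemma fourier_gaussian:
  assumes "0 < b"
  shows "fourier (gaussian b) \<xi> = complex_of_real (gauss_kernel b (\<xi>::'a::euclidean_space))"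
proof -
  have "fourier (gaussian b) \<xi> = complex_of_real (b powr (- real DIM('a) / 2)) *
     (LINT x|lborel. complex_of_real (gauss_kernel (1 / b) x) * cis (2 * pi * (x \<bullet> - \<xi>)))"
    unfolding fourier_def gaussian_eq_gauss_kernel[OF assms] integral_mult_right_zero[symmetric]
    by (simp add: mult.assoc)
  also have "\<dots> = complex_of_real (gauss_kernel b \<xi>)"
    using assms by (subst gauss_kernel_fourier) (auto simp: gauss_kernel_def)
  finally show ?thesis .
qed

lemma measurable_cnj [measurable]: "cnj \<in> borel_measurable borel"
  by (intro borel_measurable_continuous_onI continuous_intros)

text \<open>The Fourier transform of the solution at time \<open>t\<close> with initial datum \<open>gaussian b\<close>.\<close>

definition evolved_kernel :: "real \<Rightarrow> real \<Rightarrow> 'a::euclidean_space \<Rightarrow> complex" where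
  "evolved_kernel b t \<xi> = cis (- 4 * pi\<^sup>2 * t * (norm \<xi>)\<^sup>2) * complex_of_real (gauss_kernel b \<xi>)"

lemma measurable_evolved_kernel [measurable]: "evolved_kernel b t \<in> borel_measurable borel"
  unfolding evolved_kernel_def by measurable

lemma norm_evolved_kernel [simp]: "norm (evolved_kernel b t \<xi>) = gauss_kernel b \<xi>"
  by (simp add: evolved_kernel_def norm_mult)

lemma schroedinger_gaussian:
  assumes "0 < b"
  shows "schroedinger t (gaussian b) x =
    (LINT \<xi>|lborel. evolved_kernel b t \<xi> * cis (2 * pi * (x \<bullet> \<xi>)))"
  unfolding schroedinger_def inv_fourier_def fourier_gaussian[OF assms] evolved_kernel_def ..

lemma cnj_schroedinger_gaussian:
  assumes "0 < b"
  shows "cnj (schroedinger t (gaussian b) x) = fourier (\<lambda>\<xi>. cnj (evolved_kernel b t \<xi>)) x"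
  unfolding schroedinger_gaussian[OF assms] fourier_def Bochner_Integration.integral_cnj[symmetric]
  by (simp add: cis_cnj inner_commute del: Bochner_Integration.integral_cnj)

lemma measurable_schroedinger_gaussian [measurable]:
  assumes "0 < b" shows "schroedinger t (gaussian b) \<in> borel_measurable borel"
proof -
  have eq: "schroedinger t (gaussian b) =
      (\<lambda>x. LINT \<xi>|lborel. evolved_kernel b t \<xi> * cis (2 * pi * (x \<bullet> \<xi>)))"
    by (rule ext) (rule schroedinger_gaussian[OF assms])
  show ?thesis unfolding eq by measurable
qed

lemma integrable_evolved_kernel_cis:
  assumes "0 < b"
  shows "integrable lborel (\<lambda>\<xi>. evolved_kernel b t \<xi> * cis (2 * pi * (x \<bullet> \<xi>)))"
  by (rule Bochner_Integration.integrable_bound[OF integrable_gauss_kernel[OF assms]]) (auto simp: norm_mult)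

lemma norm_schroedinger_gaussian_le:
  assumes "0 < b"
  shows "norm (schroedinger t (gaussian b) (x::'a::euclidean_space)) \<le> 1"
proof -
  have "norm (schroedinger t (gaussian b) x) \<le> (LINT \<xi>|lborel. gauss_kernel b (\<xi>::'a))"
    unfolding schroedinger_gaussian[OF assms]
    by (rule Bochner_Integration.integral_norm_bound_integral)
       (auto simp: norm_mult assms intro: integrable_evolved_kernel_cis)
  then show ?thesis by (simp add: integral_gauss_kernel assms)
qed

lemma lborel_integral_translate:
  fixes f :: "'a::euclidean_space \<Rightarrow> 'b::{banach, second_countable_topology}"
  assumes [measurable]: "f \<in> borel_measurable borel"
  shows "(LINT x|lborel. f (c + x)) = (LINT x|lborel. f x)"
  by (subst (2) lborel_distr_plus[of c, symmetric]) (simp add: integral_distr)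

lemma lborel_distr_reflect: "distr lborel borel (\<lambda>x. c - x) = (lborel :: 'a::euclidean_space measure)"
  by (subst (2) lborel_affine[of "- 1" c]) (simp_all add: density_1)

lemma lborel_integral_reflect:
  fixes f :: "'a::euclidean_space \<Rightarrow> 'b::{banach, second_countable_topology}"
  assumes [measurable]: "f \<in> borel_measurable borel"
  shows "(LINT x|lborel. f (c - x)) = (LINT x|lborel. f x)"
  by (subst (2) lborel_distr_reflect[of c, symmetric]) (simp add: integral_distr)

text \<open>The parallelogram law separates the midpoint \<open>m\<close> and the difference \<open>p\<close> of two frequencies.\<close>

lemma gauss_kernel_mult:
  assumes "0 < b"
  shows "gauss_kernel b (m + (1 / 2) *\<^sub>R p) * gauss_kernel b (m - (1 / 2) *\<^sub>R p)
    = gauss_kernel (b / 2) m * gauss_kernel (2 * b) (p::'a::euclidean_space)"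
proof -
  have "(norm (m + (1 / 2) *\<^sub>R p))\<^sup>2 + (norm (m - (1 / 2) *\<^sub>R p))\<^sup>2 = 2 * (norm m)\<^sup>2 + (norm p)\<^sup>2 / 2"
    by (simp add: power2_norm_eq_inner inner_add inner_diff inner_commute)
  then have "- pi * ((norm (m + (1 / 2) *\<^sub>R p))\<^sup>2 + (norm (m - (1 / 2) *\<^sub>R p))\<^sup>2) / b
    = - pi * (2 * (norm m)\<^sup>2 + (norm p)\<^sup>2 / 2) / b"
    by simp
  then have "- pi * (norm (m + (1 / 2) *\<^sub>R p))\<^sup>2 / b + - pi * (norm (m - (1 / 2) *\<^sub>R p))\<^sup>2 / b
    = - pi * (norm m)\<^sup>2 / (b / 2) + - pi * (norm p)\<^sup>2 / (2 * b)"
    using assms by (simp add: field_simps)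
  then have E: "exp (- pi * (norm (m + (1 / 2) *\<^sub>R p))\<^sup>2 / b) * exp (- pi * (norm (m - (1 / 2) *\<^sub>R p))\<^sup>2 / b)
    = exp (- pi * (norm m)\<^sup>2 / (b / 2)) * exp (- pi * (norm p)\<^sup>2 / (2 * b))"
    by (simp only: exp_add[symmetric])
  have P: "b powr c * b powr c = (b / 2) powr c * (2 * b) powr c" for c
    using assms by (simp add: powr_mult[symmetric])
  have swap: "a * x * (c * y) = (a * c) * (x * y)" for a x c y :: real by simp
  show ?thesis
    unfolding gauss_kernel_def swap E P ..
qed

text \<open>The squared modulus of the solution is again a real Gaussian, of variance of order
  \<open>1 / b + t\<^sup>2 b\<close>. Writing it as a double integral over frequencies \<open>\<xi>\<close> and \<open>\<eta>\<close> and passing to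
  \<open>m = (\<xi> + \<eta>) / 2\<close> and \<open>p = \<xi> - \<eta>\<close>, the quadratic phase \<open>t (|\<xi>|\<^sup>2 - |\<eta>|\<^sup>2)\<close> becomes \<open>2 t m \<bullet> p\<close>. The
  integral over \<open>m\<close> and then the one over \<open>p\<close> are therefore Fourier transforms of real Gaussians.\<close>

lemma norm_schroedinger_gaussian_squared:
  fixes x :: "'a::euclidean_space"
  assumes b: "0 < b" and \<sigma>: "\<sigma> = 1 / (2 * b) + 8 * pi\<^sup>2 * t\<^sup>2 * b"
  shows "schroedinger t (gaussian b) x * cnj (schroedinger t (gaussian b) x)
    = complex_of_real ((2 * b) powr (- real DIM('a) / 2) * gauss_kernel \<sigma> x)"
proof -
  have "0 < \<sigma>" using b by (auto simp: \<sigma> intro!: add_pos_nonneg)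
  define k where "k \<xi> = evolved_kernel b t \<xi> * cis (2 * pi * (x \<bullet> \<xi>))" for \<xi> :: 'a
  have [measurable]: "k \<in> borel_measurable borel"
    unfolding k_def[abs_def] by measurable
  have nk: "norm (k \<xi>) = gauss_kernel b \<xi>" for \<xi> by (simp add: k_def norm_mult)
  have ik: "integrable lborel k"
    unfolding k_def[abs_def] by (rule integrable_evolved_kernel_cis[OF b])
  have shift: "(LINT \<xi>|lborel. f (\<xi> - p)) = (LINT \<xi>|lborel. f \<xi>)" "integrable lborel f \<Longrightarrow> integrable lborel (\<lambda>\<xi>. f (\<xi> - p))"
    if [measurable]: "f \<in> borel_measurable borel" for f :: "'a \<Rightarrow> complex" and p
  proof -
    show "(LINT \<xi>|lborel. f (\<xi> - p)) = (LINT \<xi>|lborel. f \<xi>)"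
      using lborel_integral_translate[of f "- p"] by simp
    show "integrable lborel f \<Longrightarrow> integrable lborel (\<lambda>\<xi>. f (\<xi> - p))"
      using integrable_distr_eq[of "(+) (- p)" lborel borel f] lborel_distr_plus[of "- p"] by simp
  qed
  \<comment> \<open>the phase is linear in \<open>m\<close> for fixed \<open>p\<close>\<close>
  have prod: "k (m + (1 / 2) *\<^sub>R p) * cnj (k (m - (1 / 2) *\<^sub>R p)) =
      (complex_of_real (gauss_kernel (2 * b) p) * cis (2 * pi * (p \<bullet> x))) *
      (complex_of_real (gauss_kernel (b / 2) m) * cis (2 * pi * (m \<bullet> (- (4 * pi * t)) *\<^sub>R p)))" for m p
  proof -
    have ph: "- 4 * pi\<^sup>2 * t * (norm (m + (1 / 2) *\<^sub>R p))\<^sup>2 + 2 * pi * (x \<bullet> (m + (1 / 2) *\<^sub>R p))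
        - (- 4 * pi\<^sup>2 * t * (norm (m - (1 / 2) *\<^sub>R p))\<^sup>2 + 2 * pi * (x \<bullet> (m - (1 / 2) *\<^sub>R p)))
      = 2 * pi * (p \<bullet> x) + 2 * pi * (m \<bullet> (- (4 * pi * t)) *\<^sub>R p)"
    proof -
      have d: "(norm (m + (1 / 2) *\<^sub>R p))\<^sup>2 = (norm (m - (1 / 2) *\<^sub>R p))\<^sup>2 + 2 * (m \<bullet> p)"
        by (simp add: power2_norm_eq_inner inner_add inner_diff inner_commute)
      show ?thesis
        unfolding d by (simp add: inner_add_right inner_diff_right inner_commute[of p] power2_eq_square algebra_simps)
    qed
    have "k (m + (1 / 2) *\<^sub>R p) * cnj (k (m - (1 / 2) *\<^sub>R p)) =
       complex_of_real (gauss_kernel b (m + (1 / 2) *\<^sub>R p) * gauss_kernel b (m - (1 / 2) *\<^sub>R p)) *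
       cis (- 4 * pi\<^sup>2 * t * (norm (m + (1 / 2) *\<^sub>R p))\<^sup>2 + 2 * pi * (x \<bullet> (m + (1 / 2) *\<^sub>R p))
        - (- 4 * pi\<^sup>2 * t * (norm (m - (1 / 2) *\<^sub>R p))\<^sup>2 + 2 * pi * (x \<bullet> (m - (1 / 2) *\<^sub>R p))))"
      unfolding diff_conv_add_uminus[of "_::real"] cis_mult[symmetric]
      by (simp add: k_def evolved_kernel_def cis_cnj cis_mult algebra_simps)
    also have "\<dots> = complex_of_real (gauss_kernel (b / 2) m * gauss_kernel (2 * b) p) *
       (cis (2 * pi * (p \<bullet> x)) * cis (2 * pi * (m \<bullet> (- (4 * pi * t)) *\<^sub>R p)))"
      unfolding ph gauss_kernel_mult[OF b] cis_mult ..
    finally show ?thesis by (simp add: mult_ac)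
  qed
  let ?S = "schroedinger t (gaussian b) x"
  have S: "?S = (LINT \<xi>|lborel. k \<xi>)"
    unfolding schroedinger_gaussian[OF b] k_def ..
  let ?h = "\<lambda>(\<xi>, p). k \<xi> * cnj (k (\<xi> - p))"
  have ih: "integrable (lborel \<Otimes>\<^sub>M lborel) ?h"
  proof (rule lborel_pair.Fubini_integrable)
    have e: "(LINT p|lborel. norm (?h (\<xi>, p))) = gauss_kernel b \<xi>" for \<xi>
    proof -
      have "(LINT p|lborel. norm (?h (\<xi>, p))) = gauss_kernel b \<xi> * (LINT p|lborel. gauss_kernel b (\<xi> - p))"
        by (simp add: norm_mult nk)
      also have "(\<lambda>p. gauss_kernel b (\<xi> - p)) = (\<lambda>p. gauss_kernel b (- \<xi> + p))"
        by (simp add: gauss_kernel_def norm_minus_commute)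
      also have "(LINT p|lborel. gauss_kernel b (- \<xi> + p)) = 1"
        using b by (subst lborel_integral_translate) (auto simp: integral_gauss_kernel)
      finally show ?thesis by simp
    qed
    show "integrable lborel (\<lambda>x. LINT y|lborel. norm (?h (x, y)))"
      unfolding e using b by auto
    show "AE \<xi> in lborel. integrable lborel (\<lambda>p. ?h (\<xi>, p))"
    proof (rule AE_I2)
      fix \<xi> :: 'a
      have "integrable lborel (\<lambda>p. gauss_kernel b (p - \<xi>))"
        using integrable_distr_eq[of "(+) (- \<xi>)" lborel borel "gauss_kernel b"] lborel_distr_plus[of "- \<xi>"] b by simp
      then have "integrable lborel (\<lambda>p. gauss_kernel b \<xi> * gauss_kernel b (p - \<xi>))" by simp
      then show "integrable lborel (\<lambda>p. ?h (\<xi>, p))"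
      proof (rule Bochner_Integration.integrable_bound)
        show "(\<lambda>p. ?h (\<xi>, p)) \<in> borel_measurable lborel"
          unfolding prod.case by measurable
        show "AE p in lborel. norm (?h (\<xi>, p)) \<le> norm (gauss_kernel b \<xi> * gauss_kernel b (p - \<xi>))"
          by (simp add: norm_mult nk) (simp add: gauss_kernel_def norm_minus_commute)
      qed
    qed
  qed measurable
  \<comment> \<open>for fixed \<open>\<xi>\<close> the second frequency is parametrized as \<open>\<xi> - p\<close>\<close>
  have reflected: "(LINT p|lborel. cnj (k (\<xi> - p))) = cnj ?S" for \<xi>
  proof -
    have "(LINT p|lborel. cnj (k (\<xi> - p))) = (LINT p|lborel. cnj (k p))"
      by (rule lborel_integral_reflect) measurable
    then show ?thesis by (simp add: S)
  qed
  have "?S * cnj ?S = (LINT \<xi>|lborel. k \<xi> * cnj ?S)"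
    by (simp add: S)
  also have "\<dots> = (LINT \<xi>|lborel. LINT p|lborel. k \<xi> * cnj (k (\<xi> - p)))"
    by (simp only: integral_mult_right_zero reflected)
  also have "\<dots> = (LINT p|lborel. LINT \<xi>|lborel. k \<xi> * cnj (k (\<xi> - p)))"
    by (rule lborel_pair.Fubini_integral[symmetric, OF ih])
  also have "\<dots> = (LINT p|lborel. LINT m|lborel. k (m + (1 / 2) *\<^sub>R p) * cnj (k (m - (1 / 2) *\<^sub>R p)))"
  proof (rule Bochner_Integration.integral_cong[OF refl])
    fix p :: 'a
    have "p = (1 / 2) *\<^sub>R p + (1 / 2) *\<^sub>R p" by (simp flip: scaleR_left.add)
    then have half: "m + (1 / 2) *\<^sub>R p - p = m - (1 / 2) *\<^sub>R p" for m
      by (metis add_diff_cancel_right diff_add_cancel)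
    show "(LINT \<xi>|lborel. k \<xi> * cnj (k (\<xi> - p))) = (LINT m|lborel. k (m + (1 / 2) *\<^sub>R p) * cnj (k (m - (1 / 2) *\<^sub>R p)))"
      using shift(1)[of "\<lambda>\<xi>. k \<xi> * cnj (k (\<xi> - p))" "- ((1 / 2) *\<^sub>R p)"]
      by (simp add: half)
  qed
  also have "\<dots> = (LINT p|lborel. complex_of_real (gauss_kernel (2 * b) p) * cis (2 * pi * (p \<bullet> x)) *
      complex_of_real (exp (- pi * (b / 2) * (norm ((- (4 * pi * t)) *\<^sub>R p))\<^sup>2)))"
    unfolding prod integral_mult_right_zero using b by (subst gauss_kernel_fourier) auto
  also have "\<dots> = (LINT p|lborel. complex_of_real ((2 * b) powr (- real DIM('a) / 2) * (1 / \<sigma>) powr (real DIM('a) / 2)) *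
      (complex_of_real (gauss_kernel (1 / \<sigma>) p) * cis (2 * pi * (p \<bullet> x))))"
  proof (intro Bochner_Integration.integral_cong refl)
    fix p :: 'a
    have "- pi * (norm p)\<^sup>2 / (2 * b) + - pi * (b / 2) * (norm ((- (4 * pi * t)) *\<^sub>R p))\<^sup>2 = - pi * (norm p)\<^sup>2 / (1 / \<sigma>)"
      using b by (simp add: \<sigma> power_mult_distrib field_simps power2_eq_square)
    then have "exp (- pi * (norm p)\<^sup>2 / (2 * b)) * exp (- pi * (b / 2) * (norm ((- (4 * pi * t)) *\<^sub>R p))\<^sup>2) = exp (- pi * (norm p)\<^sup>2 / (1 / \<sigma>))"
      by (simp only: exp_add[symmetric])
    moreover have "(1 / \<sigma>) powr (real DIM('a) / 2) * (1 / \<sigma>) powr (- real DIM('a) / 2) = 1"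
      using \<open>0 < \<sigma>\<close> by (simp add: powr_add[symmetric])
    ultimately have "gauss_kernel (2 * b) p * exp (- pi * (b / 2) * (norm ((- (4 * pi * t)) *\<^sub>R p))\<^sup>2)
       = (2 * b) powr (- real DIM('a) / 2) * (1 / \<sigma>) powr (real DIM('a) / 2) * gauss_kernel (1 / \<sigma>) p"
      unfolding gauss_kernel_def by (simp only: mult.assoc) (simp add: mult.assoc[symmetric])
    then have amplitude: "complex_of_real (gauss_kernel (2 * b) p) * complex_of_real (exp (- pi * (b / 2) * (norm ((- (4 * pi * t)) *\<^sub>R p))\<^sup>2))
       = complex_of_real ((2 * b) powr (- real DIM('a) / 2) * (1 / \<sigma>) powr (real DIM('a) / 2)) * complex_of_real (gauss_kernel (1 / \<sigma>) p)"
      unfolding of_real_mult[symmetric] by simp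
    have swap: "u * v * w = (u * w) * v" for u v w :: complex by simp
    show "complex_of_real (gauss_kernel (2 * b) p) * cis (2 * pi * (p \<bullet> x)) *
      complex_of_real (exp (- pi * (b / 2) * (norm ((- (4 * pi * t)) *\<^sub>R p))\<^sup>2)) =
      complex_of_real ((2 * b) powr (- real DIM('a) / 2) * (1 / \<sigma>) powr (real DIM('a) / 2)) *
      (complex_of_real (gauss_kernel (1 / \<sigma>) p) * cis (2 * pi * (p \<bullet> x)))"
      by (subst swap, subst amplitude) (rule mult.assoc)
  qed
  also have "\<dots> = complex_of_real ((2 * b) powr (- real DIM('a) / 2) * (1 / \<sigma>) powr (real DIM('a) / 2)) *
     complex_of_real (exp (- pi * (1 / \<sigma>) * (norm x)\<^sup>2))"
    unfolding integral_mult_right_zero using \<open>0 < \<sigma>\<close> by (subst gauss_kernel_fourier) auto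
  also have "\<dots> = complex_of_real ((2 * b) powr (- real DIM('a) / 2) * gauss_kernel \<sigma> x)"
  proof -
    have "(1 / \<sigma>) powr (real DIM('a) / 2) = \<sigma> powr (- real DIM('a) / 2)"
      using \<open>0 < \<sigma>\<close> by (simp add: powr_divide powr_minus_divide)
    then show ?thesis unfolding of_real_mult[symmetric] gauss_kernel_def by simp
  qed
  finally show ?thesis .
qed

lemma L2_norm_gaussian:
  assumes "0 < b"
  shows "Lp_norm 2 (modulus (gaussian b :: 'a::euclidean_space \<Rightarrow> complex)) = ennreal ((2 * b) powr (- real DIM('a) / 4))"
proof -
  have "ennpow (modulus (gaussian b) (x::'a)) 2 = ennreal ((2 * b) powr (- real DIM('a) / 2)) * ennreal (gauss_kernel (1 / (2 * b)) x)" for x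
  proof -
    have "ennpow (modulus (gaussian b) x) 2 = ennreal (exp (- pi * b * (norm x)\<^sup>2) powr 2)"
      by (simp add: modulus_def gaussian_def ennpow_ennreal)
    also have "exp (- pi * b * (norm x)\<^sup>2) powr 2 = norm (gaussian (2 * b) x)"
      by (simp add: gaussian_def powr_def mult_ac)
    also have "\<dots> = (2 * b) powr (- real DIM('a) / 2) * gauss_kernel (1 / (2 * b)) x"
      using assms by (subst gaussian_eq_gauss_kernel) (auto simp: norm_mult)
    finally show ?thesis by (simp add: ennreal_mult)
  qed
  then have "(\<integral>\<^sup>+x. ennpow (modulus (gaussian b) (x::'a)) 2 \<partial>lborel) = ennreal ((2 * b) powr (- real DIM('a) / 2))"
    using assms by (simp add: nn_integral_cmult nn_integral_gauss_kernel)
  then show ?thesis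
    by (simp add: Lp_norm_def ennpow_ennreal powr_powr)
qed

lemma norm_cis_minus_one_le: "norm (cis \<theta> - 1) \<le> \<bar>\<theta>\<bar>"
  using iexp_approx1[of \<theta> 0] by (simp add: cis_conv_exp)

text \<open>The frequency density \<open>N\<^sub>b\<close> is concentrated on \<open>|\<xi>|\<^sup>2\<close> of order \<open>b\<close>, where the phases
  \<open>4 \<pi>\<^sup>2 t |\<xi>|\<^sup>2\<close> and \<open>2 \<pi> x \<bullet> \<xi>\<close> are small if \<open>|t| b\<close> and \<open>|x|\<^sup>2 b\<close> are.\<close>

lemma schroedinger_gaussian_near_one:
  assumes "0 < \<eta>"
  obtains \<epsilon> where "0 < \<epsilon>"
    "\<And>b t (x::'a::euclidean_space). 0 < b \<Longrightarrow> \<bar>t\<bar> * b \<le> \<epsilon> \<Longrightarrow> (norm x)\<^sup>2 * b \<le> \<epsilon> \<Longrightarrow>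
      norm (schroedinger t (gaussian b) x - 1) \<le> \<eta>"
proof -
  define \<delta> where "\<delta> = \<eta> / (2 * pi)"
  have "0 < \<delta>" using assms by (simp add: \<delta>_def)
  define c where "c = moment_const TYPE('a)"
  have "0 < c" by (simp add: c_def)
  define K where "K = 4 * pi\<^sup>2 + pi / \<delta>"
  have "0 < K" using \<open>0 < \<delta>\<close> by (simp add: K_def add_pos_pos)
  define \<epsilon> where "\<epsilon> = \<eta> / (2 * K * c)"
  have "0 < \<epsilon>" using assms \<open>0 < K\<close> \<open>0 < c\<close> by (simp add: \<epsilon>_def)
  have "norm (schroedinger t (gaussian b) x - 1) \<le> \<eta>"
    if b: "0 < b" and t: "\<bar>t\<bar> * b \<le> \<epsilon>" and x: "(norm x)\<^sup>2 * b \<le> \<epsilon>" for b t and x :: 'a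
  proof -
    \<comment> \<open>the linear phase is absorbed in the quadratic one by \<open>2 u v \<le> \<delta> + u\<^sup>2 v\<^sup>2 / \<delta>\<close>\<close>
    define A where "A = 4 * pi\<^sup>2 * \<bar>t\<bar> + pi * (norm x)\<^sup>2 / \<delta>"
    have "0 \<le> A" using \<open>0 < \<delta>\<close> by (simp add: A_def)
    let ?th = "\<lambda>\<xi>. - 4 * pi\<^sup>2 * t * (norm \<xi>)\<^sup>2 + 2 * pi * (x \<bullet> \<xi>)"
    have pt: "norm (cis (?th \<xi>) - 1) \<le> pi * \<delta> + A * (norm \<xi>)\<^sup>2" for \<xi>
    proof -
      have "\<bar>?th \<xi>\<bar> \<le> 4 * pi\<^sup>2 * \<bar>t\<bar> * (norm \<xi>)\<^sup>2 + 2 * pi * \<bar>x \<bullet> \<xi>\<bar>"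
        by (rule order_trans[OF abs_triangle_ineq]) (simp add: abs_mult)
      also have "\<bar>x \<bullet> \<xi>\<bar> \<le> norm x * norm \<xi>" by (rule Cauchy_Schwarz_ineq2)
      also have "2 * pi * (norm x * norm \<xi>) \<le> pi * (\<delta> + (norm x)\<^sup>2 * (norm \<xi>)\<^sup>2 / \<delta>)"
      proof -
        have "0 \<le> (\<delta> - norm x * norm \<xi>)\<^sup>2 / \<delta>" using \<open>0 < \<delta>\<close> by simp
        also have "\<dots> = \<delta> + (norm x)\<^sup>2 * (norm \<xi>)\<^sup>2 / \<delta> - 2 * (norm x * norm \<xi>)"
          using \<open>0 < \<delta>\<close> by (simp add: field_simps power2_eq_square)
        finally have "2 * (norm x * norm \<xi>) \<le> \<delta> + (norm x)\<^sup>2 * (norm \<xi>)\<^sup>2 / \<delta>" by simp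
        from mult_left_mono[OF this, of pi] show ?thesis by simp
      qed
      also have "4 * pi\<^sup>2 * \<bar>t\<bar> * (norm \<xi>)\<^sup>2 + pi * (\<delta> + (norm x)\<^sup>2 * (norm \<xi>)\<^sup>2 / \<delta>) = pi * \<delta> + A * (norm \<xi>)\<^sup>2"
        by (simp add: A_def algebra_simps)
      finally show ?thesis using norm_cis_minus_one_le[of "?th \<xi>"] by simp
    qed
    have i: "integrable lborel (\<lambda>\<xi>. evolved_kernel b t \<xi> * cis (2 * pi * (x \<bullet> \<xi>)))"
      by (rule integrable_evolved_kernel_cis[OF b])
    have i1: "integrable lborel (\<lambda>\<xi>::'a. complex_of_real (gauss_kernel b \<xi>))"
      using b by auto
    have eq: "evolved_kernel b t \<xi> * cis (2 * pi * (x \<bullet> \<xi>)) - complex_of_real (gauss_kernel b \<xi>)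
      = complex_of_real (gauss_kernel b \<xi>) * (cis (?th \<xi>) - 1)" for \<xi>
      unfolding cis_mult[symmetric] by (simp add: evolved_kernel_def algebra_simps)
    have "schroedinger t (gaussian b) x - 1 =
        (LINT \<xi>|lborel. evolved_kernel b t \<xi> * cis (2 * pi * (x \<bullet> \<xi>)) - complex_of_real (gauss_kernel b \<xi>))"
      unfolding schroedinger_gaussian[OF b]
      using integral_gauss_kernel[OF b, where 'a='a]
      by (subst Bochner_Integration.integral_diff[OF i i1]) simp
    also have "norm \<dots> \<le> (LINT \<xi>|lborel. gauss_kernel b \<xi> * (pi * \<delta>) + A * (gauss_kernel b \<xi> * (norm (\<xi>::'a))\<^sup>2))"
    proof (rule Bochner_Integration.integral_norm_bound_integral)
      show "integrable lborel (\<lambda>\<xi>. evolved_kernel b t \<xi> * cis (2 * pi * (x \<bullet> \<xi>)) - complex_of_real (gauss_kernel b \<xi>))"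
        by (rule Bochner_Integration.integrable_diff[OF i i1])
      show "integrable lborel (\<lambda>\<xi>::'a. gauss_kernel b \<xi> * (pi * \<delta>) + A * (gauss_kernel b \<xi> * (norm \<xi>)\<^sup>2))"
        using b by (intro Bochner_Integration.integrable_add integrable_mult_left integrable_mult_right integrable_gauss_kernel_moment) auto
      show "norm (evolved_kernel b t \<xi> * cis (2 * pi * (x \<bullet> \<xi>)) - complex_of_real (gauss_kernel b \<xi>))
        \<le> gauss_kernel b \<xi> * (pi * \<delta>) + A * (gauss_kernel b \<xi> * (norm \<xi>)\<^sup>2)" for \<xi>
        unfolding eq using mult_left_mono[OF pt[of \<xi>] gauss_kernel_nonneg[of b \<xi>]]
        by (simp add: norm_mult distrib_left mult.left_commute)
    qed
    also have "\<dots> = pi * \<delta> + A * (LINT \<xi>|lborel. gauss_kernel b \<xi> * (norm (\<xi>::'a))\<^sup>2)"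
      using b integral_gauss_kernel[OF b, where 'a='a]
      by (subst Bochner_Integration.integral_add) (auto intro!: integrable_gauss_kernel_moment)
    also have "\<dots> \<le> pi * \<delta> + A * (c * b)"
      unfolding c_def using \<open>0 \<le> A\<close> by (intro add_left_mono mult_left_mono gauss_kernel_moment b)
    also have "A * (c * b) = c * (4 * pi\<^sup>2 * (\<bar>t\<bar> * b) + pi / \<delta> * ((norm x)\<^sup>2 * b))"
      by (simp add: A_def algebra_simps)
    also have "\<dots> \<le> c * (4 * pi\<^sup>2 * \<epsilon> + pi / \<delta> * \<epsilon>)"
      using \<open>0 < c\<close> \<open>0 < \<delta>\<close> by (intro mult_left_mono add_mono t x) auto
    also have "\<dots> = c * K * \<epsilon>" by (simp add: K_def algebra_simps)
    also have "\<dots> = \<eta> / 2" using \<open>0 < c\<close> \<open>0 < K\<close> by (simp add: \<epsilon>_def)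
    also have "pi * \<delta> = \<eta> / 2" by (simp add: \<delta>_def)
    finally show ?thesis by simp
  qed
  with \<open>0 < \<epsilon>\<close> show thesis using that by blast
qed

section \<open>Gaussians are Schwartz functions\<close>

lemma real_polynomial_function_derivative:
  assumes "real_polynomial_function p"
  shows "\<exists>D. (\<forall>x. (p has_derivative D x) (at x)) \<and> (\<forall>v. real_polynomial_function (\<lambda>x. D x v))"
  using assms
proof induction
  case (linear f)
  then show ?case
    by (intro exI[of _ "\<lambda>x. f"]) (auto intro: bounded_linear_imp_has_derivative)
next
  case (const c)
  then show ?case by (intro exI[of _ "\<lambda>x v. 0"]) auto
next
  case (add f g)
  then obtain D E where "\<forall>x. (f has_derivative D x) (at x)" "\<forall>v. real_polynomial_function (\<lambda>x. D x v)"
    "\<forall>x. (g has_derivative E x) (at x)" "\<forall>v. real_polynomial_function (\<lambda>x. E x v)" by blast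
  then show ?case
    by (intro exI[of _ "\<lambda>x v. D x v + E x v"]) (auto intro: has_derivative_add)
next
  case (mult f g)
  then obtain D E where "\<forall>x. (f has_derivative D x) (at x)" "\<forall>v. real_polynomial_function (\<lambda>x. D x v)"
    "\<forall>x. (g has_derivative E x) (at x)" "\<forall>v. real_polynomial_function (\<lambda>x. E x v)" by blast
  with mult.hyps have "(\<forall>x. ((\<lambda>x. f x * g x) has_derivative (\<lambda>v. f x * E x v + D x v * g x)) (at x)) \<and>
      (\<forall>v. real_polynomial_function (\<lambda>x. f x * E x v + D x v * g x))"
    by (intro conjI allI has_derivative_mult real_polynomial_function.intros(3,4)) blast+
  then show ?case by (intro exI[of _ "\<lambda>x v. f x * E x v + D x v * g x"])
qed

lemma real_polynomial_function_growth:
  assumes "real_polynomial_function p"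
  shows "\<exists>C n. 0 \<le> C \<and> (\<forall>x. \<bar>p x\<bar> \<le> C * (1 + norm x) ^ n)"
  using assms
proof induction
  case (linear f)
  then obtain K where K: "0 \<le> K" "\<And>x. norm (f x) \<le> norm x * K"
    using bounded_linear.nonneg_bounded by blast
  have "\<bar>f x\<bar> \<le> K * (1 + norm x) ^ 1" for x
    using K(2)[of x] K(1) by (simp add: algebra_simps)
  with K(1) show ?case by blast
next
  case (const c)
  show ?case by (rule exI[of _ "\<bar>c\<bar>"], rule exI[of _ 0]) auto
next
  case (add f g)
  then obtain C n E m where CE: "0 \<le> C" "\<forall>x. \<bar>f x\<bar> \<le> C * (1 + norm x) ^ n"
    "0 \<le> E" "\<forall>x. \<bar>g x\<bar> \<le> E * (1 + norm x) ^ m" by blast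
  have "\<bar>f x + g x\<bar> \<le> (C + E) * (1 + norm x) ^ (n + m)" for x
  proof -
    have "C * (1 + norm x) ^ n \<le> C * (1 + norm x) ^ (n + m)"
      using CE by (intro mult_left_mono power_increasing) auto
    moreover have "E * (1 + norm x) ^ m \<le> E * (1 + norm x) ^ (n + m)"
      using CE by (intro mult_left_mono power_increasing) auto
    ultimately show ?thesis
      using CE(2)[rule_format, of x] CE(4)[rule_format, of x] by (simp add: distrib_right) 
  qed
  then show ?case using CE by (intro exI[of _ "C + E"] exI[of _ "n + m"]) auto
next
  case (mult f g)
  then obtain C n E m where CE: "0 \<le> C" "\<forall>x. \<bar>f x\<bar> \<le> C * (1 + norm x) ^ n"
    "0 \<le> E" "\<forall>x. \<bar>g x\<bar> \<le> E * (1 + norm x) ^ m" by blast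
  have "\<bar>f x * g x\<bar> \<le> (C * E) * (1 + norm x) ^ (n + m)" for x
    using mult_mono[OF CE(2)[rule_format, of x] CE(4)[rule_format, of x]] CE
    by (simp add: abs_mult power_add mult_ac)
  then show ?case using CE by (intro exI[of _ "C * E"] exI[of _ "n + m"]) auto
qed

text \<open>Since \<open>1 + r \<le> exp r\<close>, the exponent is at most \<open>m r - \<pi> b r\<^sup>2\<close>; completing the square gives its maximum.\<close>

lemma power_mult_gaussian_bounded:
  assumes "0 < b" "0 \<le> r"
  shows "(1 + r) ^ m * exp (- pi * b * r\<^sup>2) \<le> exp ((real m)\<^sup>2 / (4 * pi * b))"
proof -
  have "(1 + r) ^ m \<le> exp r ^ m"
    using assms by (intro power_mono exp_ge_add_one_self) auto
  also have "\<dots> = exp (m * r)" by (simp add: exp_of_nat_mult)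
  finally have "(1 + r) ^ m * exp (- pi * b * r\<^sup>2) \<le> exp (m * r) * exp (- pi * b * r\<^sup>2)"
    by (intro mult_right_mono) auto
  also have "\<dots> \<le> exp ((real m)\<^sup>2 / (4 * pi * b))"
  proof -
    have "(real m)\<^sup>2 / (4 * pi * b) - (m * r - pi * b * r\<^sup>2) = (real m - 2 * pi * b * r)\<^sup>2 / (4 * pi * b)"
      using assms by (simp add: field_simps power2_eq_square)
    moreover have "0 \<le> (real m - 2 * pi * b * r)\<^sup>2 / (4 * pi * b)" using assms by simp
    ultimately show ?thesis unfolding exp_add[symmetric] exp_le_cancel_iff by simp
  qed
  finally show ?thesis .
qed

text \<open>Polynomials times a fixed Gaussian are closed under directional derivatives. This invariant makes
  all iterated derivatives of the Gaussian accessible at once.\<close>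

lemma polynomial_gaussian_derivative:
  assumes "real_polynomial_function p"
  shows "\<exists>q. (\<forall>v. real_polynomial_function (\<lambda>x. q x v)) \<and>
    (\<forall>x. ((\<lambda>x. complex_of_real (p x * exp (- pi * b * (norm (x::'a::euclidean_space))\<^sup>2)))
      has_derivative (\<lambda>v. complex_of_real (q x v * exp (- pi * b * (norm x)\<^sup>2)))) (at x))"
proof -
  obtain D where D: "\<And>x. (p has_derivative D x) (at x)" "\<And>v. real_polynomial_function (\<lambda>x. D x v)"
    using real_polynomial_function_derivative[OF assms] by blast
  have "((\<lambda>x. complex_of_real (p x * exp (- pi * b * (norm x)\<^sup>2)))
      has_derivative (\<lambda>v. complex_of_real ((D x v + p x * (- 2 * pi * b * (x \<bullet> v))) * exp (- pi * b * (norm x)\<^sup>2)))) (at x)" for x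
    unfolding power2_norm_eq_inner
    by (rule has_derivative_eq_rhs, (rule has_derivative_of_real has_derivative_mult D derivative_intros)+)
       (auto simp: fun_eq_iff algebra_simps inner_commute)
  moreover have "real_polynomial_function (\<lambda>x. D x v + p x * (- 2 * pi * b * (x \<bullet> v)))" for v
    by (intro real_polynomial_function.intros D assms bounded_linear_inner_left)
  ultimately show ?thesis by (intro exI[of _ "\<lambda>x v. D x v + p x * (- 2 * pi * b * (x \<bullet> v))"]) auto
qed

lemma iter_partial_gaussian:
  "\<exists>p. real_polynomial_function p \<and>
    iter_partial bs (gaussian b) = (\<lambda>x::'a::euclidean_space. complex_of_real (p x * exp (- pi * b * (norm x)\<^sup>2)))"
proof (induction bs)
  case Nil
  show ?case by (intro exI[of _ "\<lambda>x. 1"]) (auto simp: gaussian_def[abs_def])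
next
  case (Cons v bs)
  then obtain p where p: "real_polynomial_function p"
    and eq: "iter_partial bs (gaussian b) = (\<lambda>x::'a. complex_of_real (p x * exp (- pi * b * (norm x)\<^sup>2)))" by blast
  from polynomial_gaussian_derivative[OF p] obtain q where q: "\<And>v. real_polynomial_function (\<lambda>x. q x v)"
    "\<And>x. ((\<lambda>x. complex_of_real (p x * exp (- pi * b * (norm (x::'a))\<^sup>2)))
      has_derivative (\<lambda>v. complex_of_real (q x v * exp (- pi * b * (norm x)\<^sup>2)))) (at x)"
    by blast
  have "iter_partial (v # bs) (gaussian b) = (\<lambda>x. complex_of_real (q x v * exp (- pi * b * (norm x)\<^sup>2)))"
    unfolding iter_partial.simps eq by (intro ext) (subst frechet_derivative_at[OF q(2), symmetric], rule refl)
  with q(1) show ?case by blast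
qed

lemma schwartz_gaussian:
  assumes "0 < b"
  shows "schwartz (gaussian b :: 'a::euclidean_space \<Rightarrow> complex)"
  unfolding schwartz_def smooth_def
proof (intro conjI allI ballI)
  fix bs :: "'a list"
  obtain p where p: "real_polynomial_function p" 
    and eq: "iter_partial bs (gaussian b) = (\<lambda>x::'a. complex_of_real (p x * exp (- pi * b * (norm x)\<^sup>2)))"
    using iter_partial_gaussian by blast
  show "iter_partial bs (gaussian b :: 'a \<Rightarrow> complex) differentiable_on UNIV"
    unfolding eq differentiable_on_def differentiable_def
    using polynomial_gaussian_derivative[OF p] by blast
  fix k :: nat
  obtain C n where C: "0 \<le> C" "\<And>x. \<bar>p x\<bar> \<le> C * (1 + norm x) ^ n"
    using real_polynomial_function_growth[OF p] by blast
  show "bounded (range (\<lambda>x. norm x ^ k *\<^sub>R iter_partial bs (gaussian b :: 'a \<Rightarrow> complex) x))"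
    unfolding bounded_iff
  proof (intro exI ballI, safe)
    fix x :: 'a
    let ?e = "exp (- pi * b * (norm x)\<^sup>2)"
    have "norm (norm x ^ k *\<^sub>R iter_partial bs (gaussian b) x) = norm x ^ k * (\<bar>p x\<bar> * ?e)"
      unfolding eq by (simp add: norm_mult abs_mult del: of_real_mult)
    also have "\<dots> \<le> (1 + norm x) ^ k * ((C * (1 + norm x) ^ n) * ?e)"
      using C by (intro mult_mono power_mono mult_nonneg_nonneg) auto
    also have "\<dots> = C * ((1 + norm x) ^ (k + n) * ?e)" by (simp add: power_add mult_ac)
    also have "\<dots> \<le> C * exp ((real (k + n))\<^sup>2 / (4 * pi * b))"
      by (intro mult_left_mono power_mult_gaussian_bounded assms C) auto
    finally show "norm (norm x ^ k *\<^sub>R iter_partial bs (gaussian b) x) \<le> C * exp ((real (k + n))\<^sup>2 / (4 * pi * b))" .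
  qed
qed

section \<open>Localized solutions\<close>

lemma window_properties:
  fixes g :: "'a::euclidean_space \<Rightarrow> complex"
  assumes "window g"
  obtains B R y0 where "continuous_on UNIV g" "0 < B" "\<And>x. norm (g x) \<le> B"
    "0 < R" "\<And>x. g x \<noteq> 0 \<Longrightarrow> norm x \<le> R" "g y0 \<noteq> 0"
proof -
  have sm: "smooth g" and comp: "compact (closure {x. g x \<noteq> 0})" and n: "Lp_norm 2 (modulus g) = 1"
    using assms by (auto simp: window_def test_function_def)
  have "iter_partial [] g differentiable_on UNIV"
    using sm unfolding smooth_def by blast
  then have cont: "continuous_on UNIV g"
    by (simp add: differentiable_imp_continuous_on)
  have "compact (g ` closure {x. g x \<noteq> 0})"
    by (intro compact_continuous_image comp continuous_on_subset[OF cont]) simp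
  then have "bounded (g ` closure {x. g x \<noteq> 0})" by (rule compact_imp_bounded)
  then obtain B where "0 < B" and "\<forall>z\<in>g ` closure {x. g x \<noteq> 0}. norm z \<le> B"
    unfolding bounded_pos by blast
  then have B: "0 < B" "\<And>x. x \<in> closure {x. g x \<noteq> 0} \<Longrightarrow> norm (g x) \<le> B"
    by simp_all
  have B': "norm (g x) \<le> B" for x
    using B(1) B(2)[of x] closure_subset[of "{x. g x \<noteq> 0}"] by (cases "g x = 0") auto
  obtain R where R: "0 < R" "\<And>x. x \<in> closure {x. g x \<noteq> 0} \<Longrightarrow> norm x \<le> R"
    using compact_imp_bounded[OF comp] unfolding bounded_pos by blast
  have R': "norm x \<le> R" if "g x \<noteq> 0" for x
    using that R(2)[of x] closure_subset[of "{x. g x \<noteq> 0}"] by auto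
  have "\<exists>y0. g y0 \<noteq> 0"
  proof (rule ccontr)
    assume "\<nexists>y0. g y0 \<noteq> 0"
    then have "modulus g = (\<lambda>x. 0)" by (auto simp: modulus_def)
    then have "Lp_norm 2 (modulus g) = 0" by (simp add: Lp_norm_def ennpow_def)
    with n show False by simp
  qed
  with that[OF cont B(1) B' R(1) R'] show thesis by blast
qed

text \<open>The reciprocal exponent as a real number, \<open>0\<close> for \<open>p = \<top>\<close>.\<close>

abbreviation (input) inv_exp :: "ennreal \<Rightarrow> real" where
  "inv_exp p \<equiv> enn2real (1 / p)"

lemma ennreal_le_mult_imp_divide_le:
  assumes "0 < m" "ennreal a \<le> ennreal m * X"
  shows "ennreal (a / m) \<le> X"
proof (cases X)
  case (real v)
  then have "ennreal a \<le> ennreal (m * v)" using assms by (simp add: ennreal_mult)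
  then have "a \<le> m * v" using real assms by (simp add: ennreal_le_iff)
  then show ?thesis unfolding real using assms by (intro ennreal_leI) (simp add: field_simps)
qed simp

lemma norm_schroedinger_gaussian_mult_le:
  assumes "0 < b" "norm w \<le> B"
  shows "norm (schroedinger t (gaussian b) x * w) \<le> B"
proof -
  have "norm (schroedinger t (gaussian b) x) * norm w \<le> 1 * B"
    using assms by (intro mult_mono norm_schroedinger_gaussian_le) auto
  then show ?thesis by (simp add: norm_mult)
qed

lemma integrable_schroedinger_gaussian_window:
  fixes g :: "'a::euclidean_space \<Rightarrow> complex"
  assumes b: "0 < b" and g: "continuous_on UNIV g" "\<And>x. norm (g x) \<le> B" "\<And>x. g x \<noteq> 0 \<Longrightarrow> norm x \<le> R"
  shows "integrable lborel (\<lambda>x. schroedinger t (gaussian b) x * g (x - y))"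
proof -
  have [measurable]: "g \<in> borel_measurable borel" "schroedinger t (gaussian b) \<in> borel_measurable borel"
    using g(1) b by (auto intro: borel_measurable_continuous_onI measurable_schroedinger_gaussian)
  show ?thesis
  proof (rule integrableI_bounded_set[where A="cball y R" and B=B])
    show "emeasure lborel (cball y R) < \<infinity>"
      by (rule emeasure_lborel_cball_finite)
    show "AE x \<in> cball y R in lborel. norm (schroedinger t (gaussian b) x * g (x - y)) \<le> B"
      by (intro AE_I2 impI norm_schroedinger_gaussian_mult_le[OF b g(2)])
    show "AE x in lborel. x \<notin> cball y R \<longrightarrow> schroedinger t (gaussian b) x * g (x - y) = 0"
      using g(3)[of "_ - y"] by (auto simp: dist_norm norm_minus_commute)
  qed auto
qed

text \<open>The pairing with \<open>\<psi>\<close>, the conjugate of the Fourier transform of the solution \<open>u\<close>, is the integral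
  of \<open>|u|\<^sup>2\<close> against the translated window. Under the assumptions on \<open>b\<close> and \<open>t\<close> the Gaussian
  \<open>|u|\<^sup>2\<close> is narrow enough to see only values of \<open>g\<close> near a nonzero one, so the pairing is of the
  order of its mass \<open>b powr (- d / 2)\<close>, where \<open>d\<close> is the dimension. Dividing by \<open>M powr (1 / p)\<close> with
  \<open>M = b powr (- d / 2)\<close> gives the exponent.\<close>

lemma FLp_norm_concentrated_gaussian:
  fixes g :: "'a::euclidean_space \<Rightarrow> complex"
  assumes g: "window g" and p: "1 \<le> p"
  obtains c \<epsilon> \<delta> b1 y1 where "0 < c" "0 < \<epsilon>" "0 < \<delta>" "0 < b1"
    "\<And>b t y. b1 \<le> b \<Longrightarrow> t\<^sup>2 * b \<le> \<epsilon> \<Longrightarrow> dist y y1 < \<delta> \<Longrightarrow>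
      ennreal (c * b powr (- real DIM('a) / 2 * (1 - inv_exp p)))
        \<le> FLp_norm p (\<lambda>x. schroedinger t (gaussian b) x * g (x - y))"
proof -
  obtain B R y0 where w: "continuous_on UNIV g" "0 < B" "\<And>x. norm (g x) \<le> B"
    "0 < R" "\<And>x. g x \<noteq> 0 \<Longrightarrow> norm x \<le> R" "g y0 \<noteq> 0"
    using window_properties[OF g] by metis
  obtain \<delta> \<sigma>0 where conc: "0 < \<delta>" "0 < \<sigma>0"
    "\<And>y \<sigma>. dist y y0 < \<delta> \<Longrightarrow> 0 < \<sigma> \<Longrightarrow> \<sigma> \<le> \<sigma>0 \<Longrightarrow>
      norm (g y0) / 2 \<le> norm (LINT x|lborel. complex_of_real (gauss_kernel \<sigma> x) * g (x + y))"
    using gauss_kernel_concentrates[OF w(1,3,6)] by metis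
  define d where "d = real DIM('a) / 2"
  define c where "c = 2 powr (- d) * (norm (g y0) / 2)"
  have "0 < c" using w(6) by (simp add: c_def)
  \<comment> \<open>chosen so that each of the two summands of the variance is at most \<open>\<sigma>0 / 2\<close>\<close>
  define \<epsilon> where "\<epsilon> = \<sigma>0 / (16 * pi\<^sup>2)"
  have "0 < \<epsilon>" using conc by (simp add: \<epsilon>_def)
  have "0 < 1 / \<sigma>0" using conc by simp
  moreover have "ennreal (c * b powr (- real DIM('a) / 2 * (1 - inv_exp p)))
        \<le> FLp_norm p (\<lambda>x. schroedinger t (gaussian b) x * g (x - y))"
    if b1: "1 / \<sigma>0 \<le> b" and t: "t\<^sup>2 * b \<le> \<epsilon>" and y: "dist y (- y0) < \<delta>" for b t y
  proof -
    have b: "0 < b" using b1 \<open>0 < 1 / \<sigma>0\<close> by linarith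
    define \<sigma> where "\<sigma> = 1 / (2 * b) + 8 * pi\<^sup>2 * t\<^sup>2 * b"
    have "0 < \<sigma>" using b by (auto simp: \<sigma>_def intro!: add_pos_nonneg)
    have "1 / (2 * b) \<le> \<sigma>0 / 2" using b1 b conc by (simp add: field_simps)
    moreover have "8 * pi\<^sup>2 * t\<^sup>2 * b \<le> 8 * pi\<^sup>2 * \<epsilon>"
      using mult_left_mono[OF t, of "8 * pi\<^sup>2"] by (simp add: mult_ac)
    moreover have "8 * pi\<^sup>2 * \<epsilon> = \<sigma>0 / 2" by (simp add: \<epsilon>_def)
    ultimately have "\<sigma> \<le> \<sigma>0" by (simp add: \<sigma>_def)
    let ?F = "\<lambda>x. schroedinger t (gaussian b) x * g (x - y)"
    let ?\<psi> = "\<lambda>\<xi>::'a. cnj (evolved_kernel b t \<xi>)"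
    have product: "(\<lambda>x. ?F x * fourier ?\<psi> x) = (\<lambda>x. complex_of_real ((2 * b) powr (- d)) * (complex_of_real (gauss_kernel \<sigma> x) * g (x + - y)))"
    proof (rule ext)
      fix x
      have "?F x * fourier ?\<psi> x = (schroedinger t (gaussian b) x * cnj (schroedinger t (gaussian b) x)) * g (x + - y)"
        unfolding cnj_schroedinger_gaussian[OF b] by simp
      also have "\<dots> = complex_of_real ((2 * b) powr (- d)) * (complex_of_real (gauss_kernel \<sigma> x) * g (x + - y))"
        unfolding norm_schroedinger_gaussian_squared[OF b \<sigma>_def] d_def by simp
      finally show "?F x * fourier ?\<psi> x = \<dots>" .
    qed
    have "norm (LINT x|lborel. ?F x * fourier ?\<psi> x)
        = (2 * b) powr (- d) * norm (LINT x|lborel. complex_of_real (gauss_kernel \<sigma> x) * g (x + - y))"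
      unfolding product by (simp add: norm_mult)
    moreover have "norm (g y0) / 2 \<le> norm (LINT x|lborel. complex_of_real (gauss_kernel \<sigma> x) * g (x + - y))"
      using y \<open>0 < \<sigma>\<close> \<open>\<sigma> \<le> \<sigma>0\<close> by (intro conc(3)) (auto simp: dist_norm norm_minus_commute add.commute)
    ultimately have "(2 * b) powr (- d) * (norm (g y0) / 2) \<le> norm (LINT x|lborel. ?F x * fourier ?\<psi> x)"
      by (metis mult_left_mono powr_ge_zero)
    then have low: "c * b powr (- d) \<le> norm (LINT x|lborel. ?F x * fourier ?\<psi> x)"
      using b by (simp add: c_def powr_mult mult_ac)
    have "ennreal (norm (LINT x|lborel. ?F x * fourier ?\<psi> x))
        \<le> ennreal ((b powr (- d)) powr inv_exp p) * FLp_norm p ?F"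
    proof (rule FLp_norm_ge_pairing)
      show "integrable lborel ?F"
        by (rule integrable_schroedinger_gaussian_window[OF b w(1,3,5)])
      show "(\<integral>\<^sup>+\<xi>. ennreal (norm (?\<psi> \<xi>)) \<partial>lborel) = 1"
        using b by (simp add: nn_integral_gauss_kernel)
      show "norm (?\<psi> \<xi>) \<le> b powr (- d)" for \<xi>
        using b by (auto simp: gauss_kernel_def d_def intro!: mult_left_le)
    qed (use p in auto)
    then have "ennreal (c * b powr (- d)) \<le> ennreal ((b powr (- d)) powr inv_exp p) * FLp_norm p ?F"
      using low by (meson ennreal_leI order_trans)
    then have "ennreal (c * b powr (- d) / (b powr (- d)) powr inv_exp p) \<le> FLp_norm p ?F"
      using b by (intro ennreal_le_mult_imp_divide_le) auto
    moreover have "c * b powr (- d) / (b powr (- d)) powr inv_exp p = c * b powr (- real DIM('a) / 2 * (1 - inv_exp p))"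
    proof -
      have "- real DIM('a) / 2 * (1 - inv_exp p) = - d - - d * inv_exp p"
        by (simp add: d_def right_diff_distrib)
      then show ?thesis by (simp only: powr_diff powr_powr times_divide_eq_right)
    qed
    ultimately show ?thesis by simp
  qed
  ultimately show thesis
    using that[OF \<open>0 < c\<close> \<open>0 < \<epsilon>\<close> conc(1), of "1 / \<sigma>0" "- y0"] by blast
qed

text \<open>Near \<open>y\<close> the solution is almost the constant \<open>1\<close>, so the localized solution is almost the translated
  window itself. The test function is a modulated Gaussian whose transform is centered at
  \<open>y + y0\<close>, where the translated window takes the value \<open>g y0 \<noteq> 0\<close>.\<close>

lemma FLp_norm_spread_gaussian:
  fixes g :: "'a::euclidean_space \<Rightarrow> complex"
  assumes g: "window g" and p: "1 \<le> p"
  obtains c \<epsilon> b0 where "0 < c" "0 < \<epsilon>" "0 < b0"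
    "\<And>b t y. 0 < b \<Longrightarrow> b \<le> b0 \<Longrightarrow> \<bar>t\<bar> * b \<le> \<epsilon> \<Longrightarrow> (norm y)\<^sup>2 * b \<le> \<epsilon> \<Longrightarrow>
      ennreal c \<le> FLp_norm p (\<lambda>x. schroedinger t (gaussian b) x * g (x - y))"
proof -
  obtain B R y0 where w: "continuous_on UNIV g" "0 < B" "\<And>x. norm (g x) \<le> B"
    "0 < R" "\<And>x. g x \<noteq> 0 \<Longrightarrow> norm x \<le> R" "g y0 \<noteq> 0"
    using window_properties[OF g] by metis
  obtain \<delta> \<sigma> where "0 < \<delta>" and \<sigma>: "0 < \<sigma>"
    and conc': "\<And>y \<sigma>'. dist y y0 < \<delta> \<Longrightarrow> 0 < \<sigma>' \<Longrightarrow> \<sigma>' \<le> \<sigma> \<Longrightarrow>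
      norm (g y0) / 2 \<le> norm (LINT x|lborel. complex_of_real (gauss_kernel \<sigma>' x) * g (x + y))"
    using gauss_kernel_concentrates[OF w(1,3,6)] by metis
  have conc: "norm (g y0) / 2 \<le> norm (LINT z|lborel. complex_of_real (gauss_kernel \<sigma> z) * g (z + y0))"
    by (rule conc') (use \<open>0 < \<delta>\<close> \<sigma> in auto)
  have [measurable]: "g \<in> borel_measurable borel"
    using w(1) by (rule borel_measurable_continuous_onI)
  \<comment> \<open>replacing \<open>u\<close> by \<open>1\<close> may cost at most half of the lower bound \<open>norm (g y0) / 2\<close>\<close>
  define \<eta> where "\<eta> = norm (g y0) / (4 * B)"
  have "0 < \<eta>" using w by (simp add: \<eta>_def)
  obtain \<epsilon>' where \<epsilon>': "0 < \<epsilon>'"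
    "\<And>b t (x::'a). 0 < b \<Longrightarrow> \<bar>t\<bar> * b \<le> \<epsilon>' \<Longrightarrow> (norm x)\<^sup>2 * b \<le> \<epsilon>' \<Longrightarrow>
      norm (schroedinger t (gaussian b) x - 1) \<le> \<eta>"
    using schroedinger_gaussian_near_one[OF \<open>0 < \<eta>\<close>] by metis
  define d where "d = real DIM('a) / 2"
  define M where "M = \<sigma> powr d"
  have "0 < M" using \<sigma> by (simp add: M_def)
  define c where "c = M * (norm (g y0) / 4) / M powr inv_exp p"
  have "0 < c" using \<open>0 < M\<close> w by (simp add: c_def)
  \<comment> \<open>the square of \<open>|y| + R\<close> is at most \<open>2 (|y|\<^sup>2 + R\<^sup>2)\<close>, and each summand times \<open>b\<close> is at most \<open>\<epsilon>\<close>\<close>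
  define \<epsilon> where "\<epsilon> = \<epsilon>' / 4"
  have "0 < \<epsilon>" using \<epsilon>' by (simp add: \<epsilon>_def)
  define b0 where "b0 = \<epsilon> / R\<^sup>2"
  have "0 < b0" using \<open>0 < \<epsilon>\<close> w by (simp add: b0_def)
  have "ennreal c \<le> FLp_norm p (\<lambda>x. schroedinger t (gaussian b) x * g (x - y))"
    if b: "0 < b" and b0: "b \<le> b0" and t: "\<bar>t\<bar> * b \<le> \<epsilon>" and y: "(norm y)\<^sup>2 * b \<le> \<epsilon>" for b t y
  proof -
    let ?u = "schroedinger t (gaussian b)"
    have [measurable]: "?u \<in> borel_measurable borel" by (rule measurable_schroedinger_gaussian[OF b])
    let ?F = "\<lambda>x. ?u x * g (x - y)"
    let ?\<psi> = "\<lambda>\<xi>::'a. complex_of_real (gauss_kernel (1 / \<sigma>) \<xi>) * cis (2 * pi * (\<xi> \<bullet> (y + y0)))"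
    have four: "fourier ?\<psi> x = complex_of_real (M * gauss_kernel \<sigma> (x - (y + y0)))" for x
    proof -
      have "fourier ?\<psi> x = (LINT \<xi>|lborel. complex_of_real (gauss_kernel (1 / \<sigma>) \<xi>) * cis (2 * pi * (\<xi> \<bullet> (y + y0 - x))))"
        unfolding fourier_def by (simp add: mult.assoc cis_mult inner_diff_right right_diff_distrib inner_add_right)
      also have "\<dots> = complex_of_real (exp (- pi * (1 / \<sigma>) * (norm (y + y0 - x))\<^sup>2))"
        using \<sigma> by (intro gauss_kernel_fourier) simp
      also have "exp (- pi * (1 / \<sigma>) * (norm (y + y0 - x))\<^sup>2) = M * gauss_kernel \<sigma> (x - (y + y0))"
        unfolding norm_minus_commute[of "y + y0"] using \<sigma>
        by (simp add: gauss_kernel_def M_def d_def powr_minus)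
      finally show ?thesis .
    qed
    have meas: "(\<lambda>x. ?F x * fourier ?\<psi> x) \<in> borel_measurable borel"
      unfolding four by measurable
    have "(LINT x|lborel. ?F x * fourier ?\<psi> x) = (LINT z|lborel. ?F (y + y0 + z) * fourier ?\<psi> (y + y0 + z))"
      using lborel_integral_translate[OF meas, of "y + y0"] by simp
    also have "\<dots> = (LINT z|lborel. complex_of_real M * (complex_of_real (gauss_kernel \<sigma> z) * (?u (z + y0 + y) * g (z + y0))))"
      unfolding four by (intro Bochner_Integration.integral_cong refl) (simp add: add_ac mult_ac)
    also have "\<dots> = complex_of_real M * (LINT z|lborel. complex_of_real (gauss_kernel \<sigma> z) * (?u (z + y0 + y) * g (z + y0)))"
      by simp
    finally have I: "(LINT x|lborel. ?F x * fourier ?\<psi> x) =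
        complex_of_real M * (LINT z|lborel. complex_of_real (gauss_kernel \<sigma> z) * (?u (z + y0 + y) * g (z + y0)))" .
    have pt: "norm (?u (z + y0 + y) * g (z + y0) - g (z + y0)) \<le> \<eta> * B" for z
    proof (cases "g (z + y0) = 0")
      case False
      then have zR: "norm (z + y0) \<le> R" by (rule w(5))
      have "norm (z + y0 + y) \<le> R + norm y"
        using norm_triangle_ineq[of "z + y0" y] zR by linarith
      then have "(norm (z + y0 + y))\<^sup>2 \<le> (R + norm y)\<^sup>2" by (intro power_mono) auto
      also have "\<dots> \<le> 2 * (R\<^sup>2 + (norm y)\<^sup>2)"
        using sum_squares_ge_zero[of "R - norm y" 0] by (simp add: power2_eq_square algebra_simps)
      finally have "(norm (z + y0 + y))\<^sup>2 * b \<le> 2 * (R\<^sup>2 + (norm y)\<^sup>2) * b"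
        using b by (intro mult_right_mono) auto
      also have "\<dots> = 2 * (R\<^sup>2 * b + (norm y)\<^sup>2 * b)" by (simp add: algebra_simps)
      also have "R\<^sup>2 * b \<le> \<epsilon>" using b0 w(4) by (simp add: b0_def field_simps)
      finally have "(norm (z + y0 + y))\<^sup>2 * b \<le> \<epsilon>'" using y by (simp add: \<epsilon>_def)
      then have "norm (?u (z + y0 + y) - 1) \<le> \<eta>"
        using t \<epsilon>'(1) by (intro \<epsilon>'(2) b) (auto simp: \<epsilon>_def)
      then have "norm (?u (z + y0 + y) - 1) * norm (g (z + y0)) \<le> \<eta> * B"
        using w(3) \<open>0 < \<eta>\<close> by (intro mult_mono) auto
      then show ?thesis by (simp add: norm_mult[symmetric] left_diff_distrib)
    qed (use \<open>0 < \<eta>\<close> w in simp)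
    let ?G = "\<lambda>z. complex_of_real (gauss_kernel \<sigma> z)"
    have i1: "integrable lborel (\<lambda>z. ?G z * (?u (z + y0 + y) * g (z + y0)))"
    proof (rule integrable_gauss_kernel_mult[OF \<sigma>, where B=B])
      show "norm (?u (z + y0 + y) * g (z + y0)) \<le> B" for z
        by (rule norm_schroedinger_gaussian_mult_le[OF b w(3)])
    qed measurable
    have i2: "integrable lborel (\<lambda>z. ?G z * g (z + y0))"
      by (rule integrable_gauss_kernel_mult[OF \<sigma>, where B=B]) (use w in auto)
    have "norm ((LINT z|lborel. ?G z * (?u (z + y0 + y) * g (z + y0))) - (LINT z|lborel. ?G z * g (z + y0)))
      = norm (LINT z|lborel. ?G z * (?u (z + y0 + y) * g (z + y0) - g (z + y0)))"
      using Bochner_Integration.integral_diff[OF i1 i2] by (simp add: right_diff_distrib)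
    also have "\<dots> \<le> (LINT z|lborel. gauss_kernel \<sigma> (z::'a) * (\<eta> * B))"
    proof (rule Bochner_Integration.integral_norm_bound_integral)
      show "integrable lborel (\<lambda>z. ?G z * (?u (z + y0 + y) * g (z + y0) - g (z + y0)))"
        using Bochner_Integration.integrable_diff[OF i1 i2] by (simp add: right_diff_distrib)
      show "integrable lborel (\<lambda>z::'a. gauss_kernel \<sigma> z * (\<eta> * B))"
        using \<sigma> by auto
      show "norm (?G z * (?u (z + y0 + y) * g (z + y0) - g (z + y0))) \<le> gauss_kernel \<sigma> z * (\<eta> * B)" for z
        using mult_left_mono[OF pt[of z] gauss_kernel_nonneg[of \<sigma> z]] by (simp only: norm_mult norm_of_real abs_of_nonneg[OF gauss_kernel_nonneg])
    qed
    also have "\<dots> = norm (g y0) / 4"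
      using integral_gauss_kernel[OF \<sigma>, where 'a='a] w(2) by (simp add: \<eta>_def)
    finally have "norm (g y0) / 4 \<le> norm (LINT z|lborel. ?G z * (?u (z + y0 + y) * g (z + y0)))"
      using conc norm_triangle_ineq2[of "LINT z|lborel. ?G z * g (z + y0)" "LINT z|lborel. ?G z * (?u (z + y0 + y) * g (z + y0))"]
      by (simp add: norm_minus_commute)
    then have low: "M * (norm (g y0) / 4) \<le> norm (LINT x|lborel. ?F x * fourier ?\<psi> x)"
      unfolding I norm_mult using \<open>0 < M\<close> by (simp add: mult_left_mono)
    have "ennreal (norm (LINT x|lborel. ?F x * fourier ?\<psi> x)) \<le> ennreal (M powr inv_exp p) * FLp_norm p ?F"
    proof (rule FLp_norm_ge_pairing)
      show "integrable lborel ?F"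
        by (rule integrable_schroedinger_gaussian_window[OF b w(1,3,5)])
      show "(\<integral>\<^sup>+\<xi>. ennreal (norm (?\<psi> \<xi>)) \<partial>lborel) = 1"
        using \<sigma> by (simp add: norm_mult nn_integral_gauss_kernel)
      have "gauss_kernel (1 / \<sigma>) \<xi> \<le> M" for \<xi> :: 'a
      proof -
        have "(1 / \<sigma>) powr (- d) = M" using \<sigma> by (simp add: M_def powr_divide powr_minus)
        then show ?thesis using \<sigma> by (auto simp: gauss_kernel_def d_def intro!: mult_left_le)
      qed
      then show "norm (?\<psi> \<xi>) \<le> M" for \<xi> by (simp add: norm_mult)
    qed (use p in auto)
    then have "ennreal (M * (norm (g y0) / 4)) \<le> ennreal (M powr inv_exp p) * FLp_norm p ?F"
      using low by (meson ennreal_leI order_trans)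
    then show ?thesis
      unfolding c_def using \<open>0 < M\<close> by (intro ennreal_le_mult_imp_divide_le) auto
  qed
  then show thesis using that[OF \<open>0 < c\<close> \<open>0 < \<epsilon>\<close> \<open>0 < b0\<close>] by blast
qed

section \<open>Localization in time\<close>

lemma window_lower_bound:
  fixes h :: "real \<Rightarrow> complex"
  assumes "window h"
  obtains c \<delta> s0 where "0 < c" "0 < \<delta>" "\<And>s. dist s s0 < \<delta> \<Longrightarrow> c \<le> norm (h s)"
proof -
  obtain s0 where w: "continuous_on UNIV h" "h s0 \<noteq> 0"
    using window_properties[OF assms] by metis
  have "0 < norm (h s0) / 2" using w by simp
  then obtain \<delta> where \<delta>: "0 < \<delta>" "\<And>s. dist s s0 < \<delta> \<Longrightarrow> dist (h s) (h s0) < norm (h s0) / 2"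
    using w(1)[unfolded continuous_on_iff, rule_format, of s0 "norm (h s0) / 2"] by auto
  have "norm (h s0) / 2 \<le> norm (h s)" if "dist s s0 < \<delta>" for s
    using \<delta>(2)[OF that] norm_triangle_ineq2[of "h s0" "h s"] by (simp add: dist_norm norm_minus_commute)
  with that[OF \<open>0 < norm (h s0) / 2\<close> \<delta>(1)] show thesis by blast
qed

lemma mult_modulus_ge:
  assumes "0 \<le> A" "0 \<le> c" "ennreal A \<le> X" "c \<le> norm (h s)"
  shows "ennreal (c * A) \<le> X * modulus h s"
  using mult_mono[OF assms(3) ennreal_leI[OF assms(4)]] assms
  by (simp add: modulus_def ennreal_mult[symmetric] mult.commute)

lemma Lp_norm_ge_interval:
  fixes F :: "real \<Rightarrow> ennreal"
  assumes "0 < L" "0 \<le> c" "1 \<le> p" "\<And>x. x \<in> {a..a + L} \<Longrightarrow> ennreal c \<le> F x"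
  shows "ennreal (c * L powr inv_exp p) \<le> Lp_norm p F"
  by (rule Lp_norm_ge_on_set[where S="{a..a + L}"]) (use assms in auto)

text \<open>The interval is so short that a whole interval of translates of the window stays away from zero on
  it. Its length therefore enters only through the inner \<open>L\<^sup>\<alpha>\<close> norm.\<close>

lemma W_Lp_norm_ge_short_time:
  fixes h :: "real \<Rightarrow> complex"
  assumes h: "window h" and "1 \<le> \<alpha>" "1 \<le> \<beta>"
  obtains K \<tau>0 where "0 < K" "0 < \<tau>0"
    "\<And>A \<tau> N. 0 \<le> A \<Longrightarrow> 0 < \<tau> \<Longrightarrow> \<tau> \<le> \<tau>0 \<Longrightarrow> (\<And>t. \<bar>t\<bar> \<le> \<tau> \<Longrightarrow> ennreal A \<le> N t) \<Longrightarrow>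
      ennreal (K * A * \<tau> powr inv_exp \<alpha>) \<le> W_Lp_norm h \<alpha> \<beta> N"
proof -
  obtain c \<delta> s0 where c: "0 < c" "0 < \<delta>" "\<And>s. dist s s0 < \<delta> \<Longrightarrow> c \<le> norm (h s)"
    using window_lower_bound[OF h] by metis
  define K where "K = c * 2 powr inv_exp \<alpha> * (\<delta> / 4) powr inv_exp \<beta>"
  have "0 < K" using c by (simp add: K_def)
  have "ennreal (K * A * \<tau> powr inv_exp \<alpha>) \<le> W_Lp_norm h \<alpha> \<beta> N"
    if A: "0 \<le> A" and \<tau>: "0 < \<tau>" "\<tau> \<le> \<delta> / 4" and N: "\<And>t. \<bar>t\<bar> \<le> \<tau> \<Longrightarrow> ennreal A \<le> N t" for A \<tau> N
  proof -
    have "ennreal (c * A * (2 * \<tau>) powr inv_exp \<alpha>) \<le> Lp_norm \<alpha> (\<lambda>x. N x * modulus h (x - y))"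
      if y: "y \<in> {- s0 .. - s0 + \<delta> / 4}" for y
    proof (rule Lp_norm_ge_interval[where a="- \<tau>"])
      fix x assume x: "x \<in> {- \<tau> .. - \<tau> + 2 * \<tau>}"
      show "ennreal (c * A) \<le> N x * modulus h (x - y)"
      proof (rule mult_modulus_ge)
        show "ennreal A \<le> N x" using x by (intro N) auto
        have "\<bar>x - y - s0\<bar> \<le> \<tau> + \<delta> / 4" using x y by (auto simp: abs_le_iff)
        then show "c \<le> norm (h (x - y))"
          using \<tau> c(2) by (intro c(3)) (simp add: dist_real_def)
      qed (use A c in auto)
    qed (use A c \<tau> assms in auto)
    then have "ennreal (c * A * (2 * \<tau>) powr inv_exp \<alpha> * (\<delta> / 4) powr inv_exp \<beta>) \<le> W_Lp_norm h \<alpha> \<beta> N"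
      unfolding W_Lp_norm_def using A c \<tau> assms
      by (intro Lp_norm_ge_interval[where a="- s0" and F="\<lambda>y. Lp_norm \<alpha> (\<lambda>x. N x * modulus h (x - y))"]) simp_all
    then show ?thesis using \<tau> by (simp add: K_def powr_mult mult_ac)
  qed
  with that[OF \<open>0 < K\<close>, of "\<delta> / 4"] c(2) show thesis by auto
qed

text \<open>The interval is so long that for a fixed fraction of the translates the window lies inside it. Each contributes an inner norm of order \<open>A\<close>, and the length enters only through the outer
  \<open>L\<^sup>\<beta>\<close> norm.\<close>

lemma W_Lp_norm_ge_long_time:
  fixes h :: "real \<Rightarrow> complex"
  assumes h: "window h" and "1 \<le> \<alpha>" "1 \<le> \<beta>"
  obtains K T0 where "0 < K" "0 < T0"
    "\<And>A T N. 0 \<le> A \<Longrightarrow> T0 \<le> T \<Longrightarrow> (\<And>t. \<bar>t\<bar> \<le> T \<Longrightarrow> ennreal A \<le> N t) \<Longrightarrow>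
      ennreal (K * A * T powr inv_exp \<beta>) \<le> W_Lp_norm h \<alpha> \<beta> N"
proof -
  obtain c \<delta> s0 where c: "0 < c" "0 < \<delta>" "\<And>s. dist s s0 < \<delta> \<Longrightarrow> c \<le> norm (h s)"
    using window_lower_bound[OF h] by metis
  define K where "K = c * (\<delta> / 2) powr inv_exp \<alpha> * (1 / 2) powr inv_exp \<beta>"
  have "0 < K" using c by (simp add: K_def)
  define T0 where "T0 = 2 * \<bar>s0\<bar> + 2 * \<delta>"
  have "0 < T0" using c by (simp add: T0_def add_nonneg_pos)
  have "ennreal (K * A * T powr inv_exp \<beta>) \<le> W_Lp_norm h \<alpha> \<beta> N"
    if A: "0 \<le> A" and T: "T0 \<le> T" and N: "\<And>t. \<bar>t\<bar> \<le> T \<Longrightarrow> ennreal A \<le> N t" for A T N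
  proof -
    have "0 < T" using T \<open>0 < T0\<close> by linarith
    have "ennreal (c * A * (\<delta> / 2) powr inv_exp \<alpha>) \<le> Lp_norm \<alpha> (\<lambda>x. N x * modulus h (x - y))"
      if y: "y \<in> {0 .. 0 + T / 2}" for y
    proof (rule Lp_norm_ge_interval[where a="y + s0"])
      fix x assume x: "x \<in> {y + s0 .. y + s0 + \<delta> / 2}"
      show "ennreal (c * A) \<le> N x * modulus h (x - y)"
      proof (rule mult_modulus_ge)
        have "\<bar>x\<bar> \<le> T"
          using x y T c(2) unfolding T0_def by (auto simp: abs_le_iff)
        then show "ennreal A \<le> N x" by (rule N)
        show "c \<le> norm (h (x - y))"
          using x c(2) by (intro c(3)) (auto simp: dist_real_def)
      qed (use A c in auto)
    qed (use A c assms in auto)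
    then have "ennreal (c * A * (\<delta> / 2) powr inv_exp \<alpha> * (T / 2) powr inv_exp \<beta>) \<le> W_Lp_norm h \<alpha> \<beta> N"
      unfolding W_Lp_norm_def using A c \<open>0 < T\<close> assms
      by (intro Lp_norm_ge_interval[where a=0 and F="\<lambda>y. Lp_norm \<alpha> (\<lambda>x. N x * modulus h (x - y))"]) simp_all
    moreover have "(T / 2) powr inv_exp \<beta> = (1 / 2) powr inv_exp \<beta> * T powr inv_exp \<beta>"
      using \<open>0 < T\<close> by (subst powr_mult[symmetric]) auto
    ultimately show ?thesis by (simp add: K_def mult_ac)
  qed
  with that[OF \<open>0 < K\<close> \<open>0 < T0\<close>] show thesis by blast
qed

section \<open>Comparison of powers\<close>

lemma powr_dominated_at_top:
  assumes "0 < K" "0 < b1" "\<And>b. b1 \<le> b \<Longrightarrow> K * b powr u \<le> C * b powr (v::real)"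
  shows "u \<le> v"
proof (rule ccontr)
  assume "\<not> u \<le> v"
  then have "0 < u - v" by simp
  have "filterlim (\<lambda>b::real. b powr (u - v)) at_top at_top"
    by (rule real_powr_at_top[OF \<open>0 < u - v\<close>])
  then have "eventually (\<lambda>b. C / K < b powr (u - v)) at_top"
    by (simp add: filterlim_at_top_dense)
  moreover have "eventually (\<lambda>b. b1 \<le> b) at_top" by (rule eventually_ge_at_top)
  ultimately obtain b where b: "C / K < b powr (u - v)" "b1 \<le> b"
    using eventually_happens'[OF trivial_limit_at_top_linorder eventually_conj] by blast
  then have "0 < b" using assms by linarith
  have "C * b powr v < K * b powr (u - v) * b powr v"
    using b assms \<open>0 < b\<close> by (intro mult_strict_right_mono) (auto simp: field_simps)
  also have "\<dots> = K * b powr u" by (simp add: powr_add[symmetric] mult.assoc)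
  finally show False using assms(3)[OF b(2)] by simp
qed

lemma powr_dominated_at_0:
  assumes "0 < K" "0 < b0" "\<And>b. 0 < b \<Longrightarrow> b \<le> b0 \<Longrightarrow> K * b powr u \<le> C * b powr (v::real)"
  shows "v \<le> u"
proof -
  have "- u \<le> - v"
  proof (rule powr_dominated_at_top[OF assms(1)])
    show "0 < 1 / b0" using assms by simp
    fix b assume b: "1 / b0 \<le> b"
    then have "0 < b" using assms(2) by (meson less_le_trans zero_less_divide_1_iff)
    have "K * (1 / b) powr u \<le> C * (1 / b) powr v"
      using b \<open>0 < b\<close> assms(2) by (intro assms(3)) (auto simp: field_simps)
    then show "K * b powr - u \<le> C * b powr - v"
      using \<open>0 < b\<close> by (simp add: powr_divide powr_minus_divide)
  qed
  then show ?thesis by simp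
qed

section \<open>Necessary conditions on the exponents\<close>

lemma inv_exp_ennreal: "0 < x \<Longrightarrow> inv_exp (ennreal x) = 1 / x"
  by (simp add: ennreal_1[symmetric] divide_ennreal del: ennreal_1)

lemma inv_exp_conj_exp:
  assumes "1 \<le> r"
  shows "1 \<le> conj_exp r \<and> inv_exp (conj_exp r) = 1 - inv_exp r"
proof (cases r)
  case top
  then show ?thesis by (simp add: conj_exp_def divide_ennreal_def)
next
  case (real x)
  then have "1 \<le> x" using assms by simp
  show ?thesis
  proof (cases "x = 1")
    case True
    then show ?thesis using real by (simp add: conj_exp_def divide_ennreal_def)
  next
    case False
    define y where "y = 1 - 1 / x"
    have y: "0 < y" "y \<le> 1" using False \<open>1 \<le> x\<close> by (auto simp: y_def)
    have "1 - 1 / r = ennreal y"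
      using \<open>1 \<le> x\<close> real unfolding y_def
      by (simp add: ennreal_1[symmetric] divide_ennreal ennreal_minus del: ennreal_1)
    then have c: "conj_exp r = ennreal (1 / y)"
      using y by (simp add: conj_exp_def ennreal_1[symmetric] divide_ennreal del: ennreal_1)
    show ?thesis
      unfolding c using y real \<open>1 \<le> x\<close> by (simp add: inv_exp_ennreal y_def)
  qed
qed

context
  fixes h :: "real \<Rightarrow> complex" and g :: "'a::euclidean_space \<Rightarrow> complex"
    and \<alpha> \<beta> r :: ennreal and C :: real
  assumes h: "window h" and g: "window g" and exponents: "1 \<le> \<alpha>" "1 \<le> \<beta>" "1 \<le> r" and C: "0 < C"
    and estimate: "\<And>u\<^sub>0 :: 'a \<Rightarrow> complex. schwartz u\<^sub>0 \<Longrightarrow>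
      mixed_norm h g \<alpha> \<beta> (conj_exp r) r (\<lambda>t. schroedinger t u\<^sub>0) \<le> ennreal C * Lp_norm 2 (modulus u\<^sub>0)"
begin

lemma estimate_gaussian:
  assumes "0 < b"
    and "ennreal X \<le> mixed_norm h g \<alpha> \<beta> (conj_exp r) r (\<lambda>t. schroedinger t (gaussian b :: 'a \<Rightarrow> complex))"
  shows "X \<le> C * 2 powr (- real DIM('a) / 4) * b powr (- real DIM('a) / 4)"
proof -
  have "ennreal X \<le> ennreal (C * (2 * b) powr (- real DIM('a) / 4))"
    using order_trans[OF assms(2) estimate[OF schwartz_gaussian[OF assms(1)]]] C
    by (simp add: L2_norm_gaussian assms(1) ennreal_mult)
  then have "X \<le> C * (2 * b) powr (- real DIM('a) / 4)"
    using C by (simp add: ennreal_le_iff)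
  then show ?thesis using assms(1) by (simp add: powr_mult mult.assoc)
qed

text \<open>Here \<open>b \<rightarrow> \<infinity>\<close>, with times \<open>|t| \<le> \<surd>(\<epsilon> / b)\<close> and a fixed ball of translates.\<close>

lemma high_frequency_condition:
  "real DIM('a) / 2 \<le> real DIM('a) * inv_exp r + inv_exp \<alpha>"
proof -
  note conj = inv_exp_conj_exp[OF exponents(3), THEN conjunct1] inv_exp_conj_exp[OF exponents(3), THEN conjunct2]
  obtain c \<epsilon> \<delta> b1 y1 where loc: "0 < c" "0 < \<epsilon>" "0 < \<delta>" "0 < b1"
    "\<And>b t y. b1 \<le> b \<Longrightarrow> t\<^sup>2 * b \<le> \<epsilon> \<Longrightarrow> dist y y1 < \<delta> \<Longrightarrow>
      ennreal (c * b powr (- real DIM('a) / 2 * (1 - inv_exp (conj_exp r))))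
        \<le> FLp_norm (conj_exp r) (\<lambda>x. schroedinger t (gaussian b) x * g (x - y))"
    by (rule FLp_norm_concentrated_gaussian[OF g conj(1)]) (rule that)
  obtain K \<tau>0 where K: "0 < K" "0 < \<tau>0"
    "\<And>A \<tau> N. 0 \<le> A \<Longrightarrow> 0 < \<tau> \<Longrightarrow> \<tau> \<le> \<tau>0 \<Longrightarrow> (\<And>t. \<bar>t\<bar> \<le> \<tau> \<Longrightarrow> ennreal A \<le> N t) \<Longrightarrow>
      ennreal (K * A * \<tau> powr inv_exp \<alpha>) \<le> W_Lp_norm h \<alpha> \<beta> N"
    by (rule W_Lp_norm_ge_short_time[OF h exponents(1,2)]) (erule (1) that, blast)
  define D where "D = real DIM('a)"
  define m where "m = unit_ball_vol D * \<delta> ^ DIM('a)"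
  have "0 < m" using loc(3) by (simp add: m_def D_def)
  \<comment> \<open>from here on the time interval fits into one window\<close>
  define b2 where "b2 = max b1 (\<epsilon> / \<tau>0\<^sup>2)"
  have "0 < b2" using loc(4) by (simp add: b2_def)
  define L where "L = K * c * m powr inv_exp r * sqrt \<epsilon> powr inv_exp \<alpha>"
  have "0 < L" using K(1) loc \<open>0 < m\<close> by (simp add: L_def)
  have "L * b powr (- D / 2 * inv_exp r - inv_exp \<alpha> / 2) \<le> C * 2 powr (- D / 4) * b powr (- D / 4)"
    if b2: "b2 \<le> b" for b
  proof -
    have b: "0 < b" "b1 \<le> b" "\<epsilon> / \<tau>0\<^sup>2 \<le> b" using b2 \<open>0 < b2\<close> by (auto simp: b2_def)
    define \<tau> where "\<tau> = sqrt (\<epsilon> / b)"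
    have "0 < \<tau>" using loc b by (simp add: \<tau>_def)
    have "\<tau> \<le> \<tau>0"
      unfolding \<tau>_def using b K(2) by (intro real_le_lsqrt) (auto simp: field_simps)
    define A where "A = c * b powr (- D / 2 * inv_exp r) * m powr inv_exp r"
    have "0 \<le> A" using loc by (simp add: A_def)
    have "ennreal A \<le> W_FLp_norm g (conj_exp r) r (schroedinger t (gaussian b))" if t: "\<bar>t\<bar> \<le> \<tau>" for t
      unfolding W_FLp_norm_def A_def
    proof (rule Lp_norm_ge_on_set)
      show "emeasure lborel (ball y1 \<delta>) = ennreal m"
        using loc(3) by (simp add: emeasure_ball m_def D_def)
      have "\<bar>t\<bar>\<^sup>2 \<le> \<tau>\<^sup>2" using t by (intro power_mono) auto
      then have "t\<^sup>2 * b \<le> \<epsilon>" using b loc by (simp add: \<tau>_def field_simps)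
      then show "ennreal (c * b powr (- D / 2 * inv_exp r))
          \<le> FLp_norm (conj_exp r) (\<lambda>x. schroedinger t (gaussian b) x * g (x - y))" if "y \<in> ball y1 \<delta>" for y
        using loc(5)[OF b(2), of t y] that unfolding conj(2) D_def by (simp add: dist_commute)
    qed (use loc \<open>0 < m\<close> exponents in auto)
    then have "ennreal (K * A * \<tau> powr inv_exp \<alpha>) \<le> mixed_norm h g \<alpha> \<beta> (conj_exp r) r (\<lambda>t. schroedinger t (gaussian b))"
      unfolding mixed_norm_def by (intro K(3) \<open>0 \<le> A\<close> \<open>0 < \<tau>\<close> \<open>\<tau> \<le> \<tau>0\<close>)
    from estimate_gaussian[OF b(1) this]
    have "K * A * \<tau> powr inv_exp \<alpha> \<le> C * 2 powr (- D / 4) * b powr (- D / 4)" by (simp add: D_def)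
    moreover have "\<tau> powr inv_exp \<alpha> = sqrt \<epsilon> powr inv_exp \<alpha> * b powr (- inv_exp \<alpha> / 2)"
      using b loc by (simp add: \<tau>_def real_sqrt_divide powr_divide powr_half_sqrt[symmetric] powr_powr powr_minus_divide)
    ultimately show ?thesis
      by (simp add: L_def A_def powr_diff powr_minus_divide mult_ac)
  qed
  from powr_dominated_at_top[OF \<open>0 < L\<close> \<open>0 < b2\<close> this] show ?thesis
    by (simp add: D_def)
qed

text \<open>Here \<open>b \<rightarrow> 0\<close>, with times \<open>|t| \<le> \<epsilon> / b\<close> and translates in the ball of radius \<open>\<surd>(\<epsilon> / b)\<close>.\<close>

lemma low_frequency_condition:
  "real DIM('a) * inv_exp r + 2 * inv_exp \<beta> \<le> real DIM('a) / 2"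
proof -
  note conj = inv_exp_conj_exp[OF exponents(3), THEN conjunct1] inv_exp_conj_exp[OF exponents(3), THEN conjunct2]
  obtain c \<epsilon> b0 where loc: "0 < c" "0 < \<epsilon>" "0 < b0"
    "\<And>b t y. 0 < b \<Longrightarrow> b \<le> b0 \<Longrightarrow> \<bar>t\<bar> * b \<le> \<epsilon> \<Longrightarrow> (norm y)\<^sup>2 * b \<le> \<epsilon> \<Longrightarrow>
      ennreal c \<le> FLp_norm (conj_exp r) (\<lambda>x. schroedinger t (gaussian b) x * g (x - y))"
    by (rule FLp_norm_spread_gaussian[OF g conj(1)]) (rule that)
  obtain K T0 where K: "0 < K" "0 < T0"
    "\<And>A T N. 0 \<le> A \<Longrightarrow> T0 \<le> T \<Longrightarrow> (\<And>t. \<bar>t\<bar> \<le> T \<Longrightarrow> ennreal A \<le> N t) \<Longrightarrow>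
      ennreal (K * A * T powr inv_exp \<beta>) \<le> W_Lp_norm h \<alpha> \<beta> N"
    by (rule W_Lp_norm_ge_long_time[OF h exponents(1,2)]) (erule (1) that, blast)
  define D where "D = real DIM('a)"
  define v where "v = unit_ball_vol D * sqrt \<epsilon> ^ DIM('a)"
  have "0 < v" using loc(2) by (simp add: v_def D_def)
  \<comment> \<open>from here on the time interval is longer than the time window\<close>
  define b2 where "b2 = min b0 (\<epsilon> / T0)"
  have "0 < b2" using loc K by (simp add: b2_def)
  define L where "L = K * c * v powr inv_exp r * \<epsilon> powr inv_exp \<beta>"
  have "0 < L" using K(1) loc \<open>0 < v\<close> by (simp add: L_def)
  have "L * b powr (- D / 2 * inv_exp r - inv_exp \<beta>) \<le> C * 2 powr (- D / 4) * b powr (- D / 4)"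
    if b: "0 < b" and b2: "b \<le> b2" for b
  proof -
    have b': "b \<le> b0" "b \<le> \<epsilon> / T0" using b2 by (auto simp: b2_def)
    define T where "T = \<epsilon> / b"
    have "T0 \<le> T" using b' b K(2) by (simp add: T_def field_simps)
    define m where "m = v * b powr (- D / 2)"
    have "0 < m" using b \<open>0 < v\<close> by (simp add: m_def)
    define A where "A = c * m powr inv_exp r"
    have "0 \<le> A" using loc by (simp add: A_def)
    have "ennreal A \<le> W_FLp_norm g (conj_exp r) r (schroedinger t (gaussian b))" if t: "\<bar>t\<bar> \<le> T" for t
      unfolding W_FLp_norm_def A_def
    proof (rule Lp_norm_ge_on_set)
      have "sqrt (\<epsilon> / b) ^ DIM('a) = sqrt \<epsilon> ^ DIM('a) * b powr (- D / 2)"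
      proof -
        have "sqrt b ^ DIM('a) = b powr (D / 2)"
          using b by (simp add: D_def powr_half_sqrt[symmetric] powr_realpow[symmetric] powr_powr)
        then show ?thesis by (simp add: real_sqrt_divide power_divide powr_minus_divide)
      qed
      then show "emeasure lborel (cball (0::'a) (sqrt (\<epsilon> / b))) = ennreal m"
        using loc(2) b by (simp add: emeasure_cball m_def v_def D_def mult.assoc)
      show "ennreal c \<le> FLp_norm (conj_exp r) (\<lambda>x. schroedinger t (gaussian b) x * g (x - y))"
        if y: "y \<in> cball 0 (sqrt (\<epsilon> / b))" for y
      proof (rule loc(4)[OF b b'(1)])
        show "\<bar>t\<bar> * b \<le> \<epsilon>" using t b by (simp add: T_def field_simps)
        have "(norm y)\<^sup>2 \<le> (sqrt (\<epsilon> / b))\<^sup>2" using y by (intro power_mono) auto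
        then show "(norm y)\<^sup>2 * b \<le> \<epsilon>" using b loc by (simp add: field_simps)
      qed
    qed (use loc \<open>0 < m\<close> exponents in auto)
    then have "ennreal (K * A * T powr inv_exp \<beta>) \<le> mixed_norm h g \<alpha> \<beta> (conj_exp r) r (\<lambda>t. schroedinger t (gaussian b))"
      unfolding mixed_norm_def by (intro K(3) \<open>0 \<le> A\<close> \<open>T0 \<le> T\<close>)
    from estimate_gaussian[OF b this]
    have "K * A * T powr inv_exp \<beta> \<le> C * 2 powr (- D / 4) * b powr (- D / 4)" by (simp add: D_def)
    moreover have "T powr inv_exp \<beta> = \<epsilon> powr inv_exp \<beta> * b powr (- inv_exp \<beta>)"
      using b loc by (simp add: T_def powr_divide powr_minus_divide)
    moreover have "m powr inv_exp r = v powr inv_exp r * b powr (- D / 2 * inv_exp r)"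
      using \<open>0 < v\<close> b by (simp add: m_def powr_mult powr_powr)
    ultimately show ?thesis
      by (simp add: L_def A_def powr_diff powr_minus_divide mult_ac)
  qed
  from powr_dominated_at_0[OF \<open>0 < L\<close> \<open>0 < b2\<close> this] show ?thesis
    by (simp add: D_def)
qed

end

theorem proposition5p2:
  fixes h :: "real \<Rightarrow> complex"
    and g :: "real ^ 'd \<Rightarrow> complex"
    and \<alpha> \<beta> r :: ennreal
    and C :: real
  assumes "window h" and "window g"
    and "1 \<le> \<alpha>" and "1 \<le> \<beta>" and "1 \<le> r" and "0 < C"
    and "\<And>u\<^sub>0 :: real ^ 'd \<Rightarrow> complex. schwartz u\<^sub>0 \<Longrightarrow>
      mixed_norm h g \<alpha> \<beta> (conj_exp r) r (\<lambda>t. schroedinger t u\<^sub>0)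
        \<le> ennreal C * Lp_norm 2 (modulus u\<^sub>0)"
  shows "2 \<le> r \<and>
    (\<forall>q :: ennreal. 2 / q + of_nat CARD('d) / r = of_nat CARD('d) / 2
      \<longrightarrow> \<alpha> \<le> q / 2 \<and> q \<le> \<beta>)"
proof -
  define D where "D = real CARD('d)"
  have "0 < D" by (simp add: D_def)
  have high: "D / 2 \<le> D * inv_exp r + inv_exp \<alpha>"
    using high_frequency_condition[OF assms] by (simp add: D_def)
  have low: "D * inv_exp r + 2 * inv_exp \<beta> \<le> D / 2"
    using low_frequency_condition[OF assms] by (simp add: D_def)
  have finite_case: "\<exists>x\<ge>1. p = ennreal x \<and> inv_exp p = 1 / x" if "1 \<le> p" "p \<noteq> \<top>" for p
  proof (cases p)
    case (real x)
    then show ?thesis using that inv_exp_ennreal[of x] by (intro exI[of _ x]) auto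
  qed (use that in simp)
  have "2 \<le> r"
  proof (cases "r = \<top>")
    case False
    then obtain x where x: "1 \<le> x" "r = ennreal x" "inv_exp r = 1 / x"
      using finite_case assms(5) by blast
    have "D * (1 / x) \<le> D * (1 / 2)" using low enn2real_nonneg[of "1 / \<beta>"] unfolding x(3) by linarith
    then have "1 / x \<le> 1 / 2" using \<open>0 < D\<close> by (simp only: mult_le_cancel_left_pos)
    then have "2 \<le> x" using x(1) by (simp add: field_simps)
    then show ?thesis unfolding x(2) using ennreal_leI[of 2 x] by simp
  qed simp
  moreover have "\<alpha> \<le> q / 2 \<and> q \<le> \<beta>" if q: "2 / q + of_nat CARD('d) / r = of_nat CARD('d) / 2" for q :: ennreal
  proof -
    have Dr: "of_nat CARD('d) / r = ennreal (D * inv_exp r)"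
    proof (cases "r = \<top>")
      case False
      then obtain x where "1 \<le> x" "r = ennreal x" "inv_exp r = 1 / x"
        using finite_case assms(5) by blast
      then show ?thesis by (simp add: D_def ennreal_of_nat_eq_real_of_nat divide_ennreal)
    qed simp
    have D2: "of_nat CARD('d) / 2 = ennreal (D / 2)"
      by (simp add: D_def ennreal_of_nat_eq_real_of_nat divide_ennreal ennreal_numeral[symmetric] del: ennreal_numeral)
    show ?thesis
    proof (cases q)
      case top
      then have "D * inv_exp r = D / 2"
        using q unfolding Dr D2 using \<open>0 < D\<close> by (simp add: enn2real_nonneg)
      then have "inv_exp \<beta> \<le> 0" using low by linarith
      then have "\<beta> = \<top>" using finite_case[OF assms(4)] by fastforce
      then show ?thesis using top by (simp add: ennreal_top_divide)
    next
      case (real Q)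
      have "Q \<noteq> 0"
      proof
        assume "Q = 0"
        then show False using q real unfolding D2 by simp
      qed
      with real have Q: "0 < Q" "q = ennreal Q" by auto
      have "ennreal (2 / Q + D * inv_exp r) = ennreal (D / 2)"
        using q Q \<open>0 < D\<close> unfolding Dr D2
        by (simp add: ennreal_numeral[symmetric] divide_ennreal del: ennreal_numeral)
      then have scal: "2 / Q + D * inv_exp r = D / 2"
        using Q(1) \<open>0 < D\<close> by (subst (asm) ennreal_inj) (auto simp: enn2real_nonneg)
      have "2 / Q \<le> inv_exp \<alpha>" using high scal by linarith
      then have "0 < inv_exp \<alpha>" using Q(1) by (meson divide_pos_pos less_le_trans zero_less_numeral)
      then have "\<alpha> \<noteq> \<top>" by auto
      then obtain a where a: "1 \<le> a" "\<alpha> = ennreal a" "inv_exp \<alpha> = 1 / a"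
        using finite_case assms(3) by blast
      have "a \<le> Q / 2" using \<open>2 / Q \<le> inv_exp \<alpha>\<close>[unfolded a(3)] a(1) Q(1) by (simp add: field_simps)
      then have "\<alpha> \<le> q / 2"
        unfolding a(2) Q(2) using Q(1)
        by (simp add: ennreal_numeral[symmetric] divide_ennreal ennreal_leI del: ennreal_numeral)
      moreover have "q \<le> \<beta>"
      proof (cases "\<beta> = \<top>")
        case False
        then obtain c where c: "1 \<le> c" "\<beta> = ennreal c" "inv_exp \<beta> = 1 / c"
          using finite_case assms(4) by blast
        have "2 * (1 / c) \<le> 2 / Q" using low scal c(3) by simp
        then have "Q \<le> c" using c(1) Q(1) by (simp add: field_simps)
        then show ?thesis unfolding c(2) Q(2) by (rule ennreal_leI)
      qed simp
      ultimately show ?thesis by simp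
    qed
  qed
  ultimately show ?thesis by blast
qed

end
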